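(* Fix $T>0$. For integers $n,m\ge 1$, let $\mathcal H_{\mathbb H}(n,m)\in\mathbb N\cup\{+\infty\}$ be the supremum of the number of limit cycles of the Abel equation $$\frac{dx}{dt}=A(t)x^3+B(t)x^2,\qquad t\in[-T,T],$$ over all functions $A(t)=a_0+\sum_{i=1}^n\big(a_i\cosh(it)+b_i\sinh(it)\big)$ and $B(t)=c_0+\sum_{j=1}^m\big(c_j\cosh(jt)+d_j\sinh(jt)\big)$ with real coefficients. Then $$\mathcal H_{\mathbb H}(n,m)\ \ge\ 2m+1.$$
   Context: A closed solution of the equation is a solution defined on all of $[-T,T]$ with $x(-T)=x(T)$; a limit cycle is a closed solution that is isolated among closed solutions (i.e. its initial value $x(-T)$ is isolated in the set of initial values of closed solutions). The solution $x\equiv0$ is counted if isolated. *)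

theory Defs
  imports "HOL-Analysis.Analysis"
begin

definition hyperbolic_poly :: "nat \<Rightarrow> (real \<Rightarrow> real) set" where
  "hyperbolic_poly n =
     {f. \<exists>a b :: nat \<Rightarrow> real. \<forall>t. f t =
           a 0 + (\<Sum>i=1..n. a i * cosh (real i * t) + b i * sinh (real i * t))}"

text \<open>
  A solution is a function on the interval only. Requiring
  \<^term>\<open>x \<in> extensional {-T..T}\<close> picks one total function for each such function,
  so that solutions can be counted. At the end points the derivative is one-sided.
\<close>

definition abel_solution ::
    "real \<Rightarrow> (real \<Rightarrow> real) \<Rightarrow> (real \<Rightarrow> real) \<Rightarrow> (real \<Rightarrow> real) \<Rightarrow> bool" where
  "abel_solution T A B x \<longleftrightarrow>
     x \<in> extensional {-T..T} \<and>
     (\<forall>t\<in>{-T..T}.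
        (x has_real_derivative A t * x t ^ 3 + B t * x t ^ 2) (at t within {-T..T}))"

definition closed_solutions ::
    "real \<Rightarrow> (real \<Rightarrow> real) \<Rightarrow> (real \<Rightarrow> real) \<Rightarrow> (real \<Rightarrow> real) set" where
  "closed_solutions T A B = {x. abel_solution T A B x \<and> x (-T) = x T}"

definition limit_cycles ::
    "real \<Rightarrow> (real \<Rightarrow> real) \<Rightarrow> (real \<Rightarrow> real) \<Rightarrow> (real \<Rightarrow> real) set" where
  "limit_cycles T A B =
     {x \<in> closed_solutions T A B.
        x (-T) isolated_in ((\<lambda>y. y (-T)) ` closed_solutions T A B)}"

definition set_size :: "'a set \<Rightarrow> enat" where
  "set_size S = (if finite S then enat (card S) else \<infinity>)"

definition hilbert_number :: "real \<Rightarrow> nat \<Rightarrow> nat \<Rightarrow> enat" where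
  "hilbert_number T n m =
     (SUP (A, B) \<in> hyperbolic_poly n \<times> hyperbolic_poly m. set_size (limit_cycles T A B))"

end

theory Submission
  imports Defs
begin

text \<open>
  Take \<open>A = sinh\<close> and \<open>B = \<epsilon> P\<close> with \<open>P\<close> a polynomial of degree \<open>m\<close> in \<open>q t = cosh T - cosh t\<close>.
  The substitution \<open>x = \<xi> / sqrt Y\<close> turns the Abel equation with \<open>x (-T) = \<xi>\<close> into
  \<open>Y' = -2 \<xi>\<^sup>2 sinh t - 2 \<epsilon> \<xi> P sqrt Y\<close>, \<open>Y (-T) = 1\<close>, which remains regular at \<open>\<xi> = 0\<close> and treats both
  signs of \<open>\<xi>\<close> alike. Since \<open>sinh\<close> is odd, the solution is closed iff \<open>\<xi> = 0\<close> or \<open>\<integral> P sqrt Y = 0\<close>.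

  For \<open>\<epsilon> \<longrightarrow> 0\<close> this integral tends to \<open>\<integral> P sqrt (1 + 2 \<xi>\<^sup>2 q)\<close>. Because the Gram matrix of the powers
  of \<open>q\<close> is invertible, \<open>P\<close> can be chosen so that, for \<open>\<xi> = \<sigma> \<tau>\<close> and small \<open>\<sigma>\<close>, the latter is
  \<open>\<sigma>\<^bsup>2m\<^esup>\<close> times \<open>(\<tau>\<^sup>2 - 1\<^sup>2) \<dots> (\<tau>\<^sup>2 - m\<^sup>2)\<close> plus an error of Lipschitz constant \<open>O(\<sigma>\<^sup>2)\<close>. All perturbations are small
  in the Lipschitz sense, so the \<open>2 m\<close> simple roots persist as isolated ones; together with
  \<open>\<xi> = 0\<close> they give \<open>2 m + 1\<close> limit cycles.
\<close>

section \<open>Uniqueness and existence for differential equations\<close>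

text \<open>An integrating factor does the work: with \<open>I\<close> a primitive of
  \<open>a\<close>, the product \<open>d * exp (- I)\<close> has derivative zero, so it is constant,
  and it vanishes at \<open>l\<close>.\<close>

lemma linear_ode_zero:
  fixes d a :: "real \<Rightarrow> real"
  assumes a: "continuous_on {l..r} a"
    and d: "\<And>t. t \<in> {l..r} \<Longrightarrow> (d has_real_derivative a t * d t) (at t within {l..r})"
    and "d l = 0" and t: "t \<in> {l..r}"
  shows "d t = 0"
proof -
  define I where "I = (\<lambda>t. integral {l..t} a)"
  have I: "(I has_real_derivative a t) (at t within {l..r})" if "t \<in> {l..r}" for t
    unfolding I_def by (rule integral_has_real_derivative[OF a that])
  have "((\<lambda>t. d t * exp (- I t)) has_real_derivative 0) (at t within {l..r})"
    if "t \<in> {l..r}" for t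
    by (rule derivative_eq_intros d I that refl)+ (simp add: algebra_simps)
  then have "\<exists>c. \<forall>t\<in>{l..r}. d t * exp (- I t) = c"
    by (intro has_field_derivative_zero_constant) auto
  then obtain c where c: "\<And>t. t \<in> {l..r} \<Longrightarrow> d t * exp (- I t) = c" by blast
  have "l \<in> {l..r}" using t by auto
  from c[OF this] \<open>d l = 0\<close> have "c = 0" by simp
  with c[OF t] show ?thesis by simp
qed

lemma abel_solution_continuous_on:
  "abel_solution T A B x \<Longrightarrow> continuous_on {-T..T} x"
  unfolding abel_solution_def
  by (intro DERIV_continuous_on[where D="\<lambda>t. A t * x t ^ 3 + B t * x t ^ 2"]) auto

text \<open>This allows closed solutions to be identified by their initial values alone. Equality
  holds as total functions because extensionality forces both to be \<open>undefined\<close> off the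
  interval.\<close>

lemma abel_solution_unique:
  assumes A: "continuous_on {-T..T} A" and B: "continuous_on {-T..T} B"
    and x: "abel_solution T A B x" and y: "abel_solution T A B y"
    and init: "x (-T) = y (-T)"
  shows "x = y"
proof
  fix t
  \<comment> \<open>The difference of two solutions satisfies \<open>d' = a d\<close>.\<close>
  define a where "a = (\<lambda>t. A t * ((x t)\<^sup>2 + x t * y t + (y t)\<^sup>2) + B t * (x t + y t))"
  have a: "continuous_on {-T..T} a"
    unfolding a_def
    by (intro continuous_intros A B abel_solution_continuous_on[OF x] abel_solution_continuous_on[OF y])
  show "x t = y t"
  proof (cases "t \<in> {-T..T}")
    case True
    have "x t - y t = 0"
    proof (rule linear_ode_zero[where d="\<lambda>t. x t - y t", OF a _ _ True])
      fix s assume s: "s \<in> {-T..T}"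
      have "((\<lambda>t. x t - y t) has_real_derivative
          (A s * x s ^ 3 + B s * x s ^ 2) - (A s * y s ^ 3 + B s * y s ^ 2)) (at s within {-T..T})"
        using x y s unfolding abel_solution_def by (intro DERIV_diff) auto
      then show "((\<lambda>t. x t - y t) has_real_derivative a s * (x s - y s)) (at s within {-T..T})"
        by (rule DERIV_cong) (simp add: a_def algebra_simps power2_eq_square power3_eq_cube)
    qed (use init in simp)
    then show ?thesis by simp
  next
    case False
    then show ?thesis using x y
      unfolding abel_solution_def by (auto simp: extensional_def)
  qed
qed

section \<open>A Volterra integral equation with small kernel\<close>

lemma integral_abs_bound:
  fixes f :: "real \<Rightarrow> real"
  assumes "continuous_on {l..r} f" and "\<And>s. s \<in> {l..r} \<Longrightarrow> \<bar>f s\<bar> \<le> b" and "t \<in> {l..r}"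
  shows "\<bar>integral {l..t} f\<bar> \<le> b * (r - l)"
proof -
  have "l \<in> {l..r}" using assms by auto
  then have "0 \<le> b" using assms(2)[of l] by linarith
  have "norm (integral {l..t} f) \<le> b * (t - l)"
    using assms by (intro integral_bound) (auto intro: continuous_on_subset)
  also have "\<dots> \<le> b * (r - l)"
    using \<open>0 \<le> b\<close> assms by (intro mult_left_mono) auto
  finally show ?thesis by simp
qed

text \<open>Banach's fixed point theorem in the sup norm. Since \<open>k\<close> is small and \<phi>
  has Lipschitz constant 1, the right-hand side is a contraction with factor 1/2 on the whole
  interval at once, so no gluing of local solutions is needed.\<close>

lemma volterra_fixed_point:
  fixes \<phi> P g :: "real \<Rightarrow> real"
  assumes lr: "l \<le> r" and P: "continuous_on {l..r} P" and g: "continuous_on {l..r} g"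
    and \<beta>: "\<And>t. t \<in> {l..r} \<Longrightarrow> \<bar>P t\<bar> \<le> \<beta>"
    and \<phi>: "\<And>a b. \<bar>\<phi> a - \<phi> b\<bar> \<le> \<bar>a - b\<bar>"
    and k: "\<bar>k\<bar> * \<beta> * (r - l) \<le> 1/2"
  shows "\<exists>Y. continuous_on {l..r} Y \<and>
    (\<forall>t\<in>{l..r}. Y t = g t + k * integral {l..t} (\<lambda>s. P s * \<phi> (Y s)))"
proof -
  \<comment> \<open>Clamping the time extends continuous functions on \<open>{l..r}\<close> to
    bounded continuous functions on the line. These form a complete type, to which
    \<open>banach_fix_type\<close> applies.\<close>
  define c where "c = (\<lambda>t. max l (min r t))"
  define \<Phi> where "\<Phi> = (\<lambda>(Y::real \<Rightarrow>\<^sub>C real) t. g t + k * integral {l..t} (\<lambda>s. P s * \<phi> (Y s)))"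
  have c_in: "c t \<in> {l..r}" for t using lr by (auto simp: c_def)
  have c_cont: "continuous_on UNIV c" unfolding c_def by (intro continuous_intros)
  have "1-lipschitz_on UNIV \<phi>"
    by (rule lipschitz_onI) (auto simp: dist_real_def \<phi>)
  then have \<phi>c: "continuous_on UNIV \<phi>" by (rule lipschitz_on_continuous_on)
  have int: "continuous_on {l..r} (\<lambda>s. P s * \<phi> (apply_bcontfun Y s))" for Y
    by (intro continuous_intros P continuous_on_compose2[OF \<phi>c]) auto
  have \<Phi>_cont: "continuous_on {l..r} (\<Phi> Y)" for Y
    unfolding \<Phi>_def
    by (intro continuous_intros g indefinite_integral_continuous_1 integrable_continuous_real int)
  have \<Phi>_bc: "(\<lambda>t. \<Phi> Y (c t)) \<in> bcontfun" for Y
  proof -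
    have "continuous_on UNIV (\<lambda>t. \<Phi> Y (c t))"
      by (rule continuous_on_compose2[OF \<Phi>_cont c_cont]) (use c_in in auto)
    moreover have "bounded (\<Phi> Y ` {l..r})"
      using \<Phi>_cont by (intro compact_imp_bounded compact_continuous_image) auto
    then have "bounded (range (\<lambda>t. \<Phi> Y (c t)))"
      by (rule bounded_subset) (use c_in in auto)
    ultimately show ?thesis by (simp add: bcontfun_def)
  qed
  define F where "F = (\<lambda>Y. Bcontfun (\<lambda>t. \<Phi> Y (c t)))"
  have F: "apply_bcontfun (F Y) t = \<Phi> Y (c t)" for Y t
    unfolding F_def using \<Phi>_bc by (simp add: Bcontfun_inverse)
  have "dist (F X) (F Y) \<le> 1/2 * dist X Y" for X Y
  proof (rule dist_bound)
    fix t
    have int': "(\<lambda>s. P s * \<phi> (apply_bcontfun Y s)) integrable_on {l..c t}" for Y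
      using c_in[of t] by (intro integrable_continuous_real continuous_on_subset[OF int]) auto
    have "\<Phi> X (c t) - \<Phi> Y (c t) =
        k * integral {l..c t} (\<lambda>s. P s * \<phi> (X s) - P s * \<phi> (Y s))"
      unfolding \<Phi>_def
      by (subst integral_diff[OF int' int']) (simp add: algebra_simps)
    also have "\<bar>\<dots>\<bar> \<le> \<bar>k\<bar> * ((\<beta> * dist X Y) * (r - l))"
      unfolding abs_mult
    proof (intro mult_left_mono integral_abs_bound)
      fix s assume s: "s \<in> {l..r}"
      have "\<bar>P s * \<phi> (X s) - P s * \<phi> (Y s)\<bar> = \<bar>P s\<bar> * \<bar>\<phi> (X s) - \<phi> (Y s)\<bar>"
        by (simp add: abs_mult[symmetric] algebra_simps)
      also have "\<dots> \<le> \<beta> * dist X Y"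
      proof (intro mult_mono \<beta> s)
        show "\<bar>\<phi> (X s) - \<phi> (Y s)\<bar> \<le> dist X Y"
          using \<phi>[of "X s" "Y s"] dist_bounded[of X s Y] by (simp add: dist_real_def)
      qed (use \<beta>[OF s] in auto)
      finally show "\<bar>P s * \<phi> (X s) - P s * \<phi> (Y s)\<bar> \<le> \<beta> * dist X Y" .
    qed (use c_in in \<open>auto intro: continuous_on_diff int\<close>)
    also have "\<dots> = (\<bar>k\<bar> * \<beta> * (r - l)) * dist X Y" by simp
    also have "\<dots> \<le> 1/2 * dist X Y" by (intro mult_right_mono k) auto
    finally show "dist (F X t) (F Y t) \<le> 1/2 * dist X Y"
      by (simp add: F dist_real_def)
  qed
  then have "\<forall>X Y. dist (F X) (F Y) \<le> 1/2 * dist X Y" by blast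
  from banach_fix_type[OF _ _ this] obtain Y where "F Y = Y" by auto
  then have "Y t = \<Phi> Y t" if "t \<in> {l..r}" for t
    using F[of Y t] that by (auto simp: c_def)
  then show ?thesis
    by (intro exI[of _ "apply_bcontfun Y"]) (auto simp: \<Phi>_def)
qed

section \<open>Perturbation of the center\<close>

text \<open>Both roots are at least 1/2, so their sum is at least 1. The threshold 1/4 is chosen to
  give the Lipschitz constant 1 required of \<phi> in \<open>volterra_fixed_point\<close>.\<close>

lemma abs_sqrt_diff_le:
  fixes a b :: real
  assumes "a \<ge> 1/4" "b \<ge> 1/4"
  shows "\<bar>sqrt a - sqrt b\<bar> \<le> \<bar>a - b\<bar>"
proof -
  have "sqrt (1/4) \<le> sqrt a" "sqrt (1/4) \<le> sqrt b" using assms by (simp_all only: real_sqrt_le_iff)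
  then have s: "1/2 \<le> sqrt a" "1/2 \<le> sqrt b" by (simp_all add: real_sqrt_divide)
  have "a - b = (sqrt a)\<^sup>2 - (sqrt b)\<^sup>2" using assms by simp
  also have "\<dots> = (sqrt a - sqrt b) * (sqrt a + sqrt b)"
    by (simp add: power2_eq_square algebra_simps)
  finally have "\<bar>a - b\<bar> = \<bar>sqrt a - sqrt b\<bar> * (sqrt a + sqrt b)"
    using s by (simp add: abs_mult)
  moreover have "\<bar>sqrt a - sqrt b\<bar> * 1 \<le> \<bar>sqrt a - sqrt b\<bar> * (sqrt a + sqrt b)"
    using s by (intro mult_left_mono) auto
  ultimately show ?thesis by simp
qed

text \<open>Every term of the bound contains a numerator or a difference of numerators. A small
  factor common to the numerators is therefore inherited by the Lipschitz constant of the
  quotient.\<close>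

lemma abs_quotient_diff_le:
  fixes a b s r :: real
  assumes "s \<ge> 1" "r \<ge> 1"
  shows "\<bar>a / s - b / r\<bar> \<le> \<bar>a - b\<bar> + \<bar>b\<bar> * \<bar>s - r\<bar>"
proof -
  have "a / s - b / r = (a - b) / s + b * (r - s) / (s * r)"
    using assms by (simp add: field_simps)
  also have "\<bar>\<dots>\<bar> \<le> \<bar>(a - b) / s\<bar> + \<bar>b * (r - s) / (s * r)\<bar>" by (rule abs_triangle_ineq)
  also have "\<bar>(a - b) / s\<bar> \<le> \<bar>a - b\<bar>"
    using assms mult_left_mono[of 1 s "\<bar>a - b\<bar>"] by (simp add: abs_divide divide_le_eq)
  also have "\<bar>b * (r - s) / (s * r)\<bar> \<le> \<bar>b\<bar> * \<bar>s - r\<bar>"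
  proof -
    have "1 * 1 \<le> s * r" using assms by (intro mult_mono) auto
    then show ?thesis using mult_left_mono[of 1 "s * r" "\<bar>b\<bar> * \<bar>s - r\<bar>"] assms
      by (simp add: abs_mult abs_divide divide_le_eq abs_minus_commute)
  qed
  finally show ?thesis by simp
qed

lemma cosh_diff_bounds:
  fixes t :: real
  assumes "t \<in> {-T..T}"
  shows "0 \<le> cosh T - cosh t" and "cosh T - cosh t \<le> cosh T"
proof -
  have "cosh \<bar>t\<bar> \<le> cosh \<bar>T\<bar>" using assms by (subst cosh_real_nonneg_le_iff) auto
  then show "0 \<le> cosh T - cosh t" by simp
qed simp

text \<open>The condition for closing up is exact: \<open>R\<close> collects the error of replacing
  the true \<open>Y\<close> by its value at zero perturbation. Since \<open>R\<close> is of order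
  \<epsilon> in the Lipschitz sense, a small \<epsilon> gives any prescribed \<eta>. Lipschitz
  bounds replace differentiability with respect to the initial value. The factor \<xi> accounts for
  the zero solution.\<close>

lemma perturbed_center:
  fixes T \<Xi> \<eta> :: real and P :: "real \<Rightarrow> real"
  assumes T: "T > 0" and P: "continuous_on {-T..T} P" and \<Xi>: "\<Xi> > 0" and \<eta>: "\<eta> > 0"
  shows "\<exists>\<epsilon> R. R 0 = 0 \<and>
    (\<forall>x\<in>{-\<Xi>..\<Xi>}. \<forall>y\<in>{-\<Xi>..\<Xi>}. \<bar>R x - R y\<bar> \<le> \<eta> * \<bar>x - y\<bar>) \<and>
    (\<forall>\<xi>\<in>{-\<Xi>..\<Xi>}. \<exists>x. abel_solution T sinh (\<lambda>t. \<epsilon> * P t) x \<and> x (-T) = \<xi> \<and>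
      (x T = \<xi> \<longleftrightarrow>
        \<xi> * (integral {-T..T} (\<lambda>t. P t * sqrt (1 + 2 * \<xi>\<^sup>2 * (cosh T - cosh t))) + R \<xi>) = 0))"
proof -
  define q where "q = (\<lambda>t. cosh T - cosh t)"
  define Q where "Q = cosh T"
  have q: "0 \<le> q t" "q t \<le> Q" if "t \<in> {-T..T}" for t
    using cosh_diff_bounds[OF that] by (auto simp: q_def Q_def)
  have Q: "Q > 0" by (simp add: Q_def)
  have q_cont: "continuous_on S q" for S unfolding q_def by (intro continuous_intros)
  have "bounded (P ` {-T..T})"
    by (intro compact_imp_bounded compact_continuous_image P) auto
  then obtain \<beta> where \<beta>0: "\<beta> > 0" and \<beta>: "\<And>t. t \<in> {-T..T} \<Longrightarrow> \<bar>P t\<bar> \<le> \<beta>"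
    unfolding bounded_pos by auto
  \<comment> \<open>\<open>M\<close> will bound \<open>Y\<close> from above, with room left for the
    perturbation. \<open>D\<close> bounds the integral of \<open>\<bar>P\<bar>\<close>,
    \<open>L\<close> is a Lipschitz constant of \<open>Y\<close> in \<xi>, and \<epsilon> times
    \<open>C\<close> is one of \<open>G\<close>.\<close>
  define M where "M = 2 + 2 * \<Xi>\<^sup>2 * Q"
  have M: "M \<ge> 2" using Q by (simp add: M_def)
  define D where "D = \<beta> * (2 * T)"
  have D: "D > 0" using \<beta>0 T by (simp add: D_def)
  define L where "L = 8 * \<Xi> * Q + 1"
  have L: "L \<ge> 1" "4 * \<Xi> * Q \<le> L" using Q \<Xi> by (auto simp: L_def)
  define C where "C = 2 * (D * M + \<Xi> * (D * L)) + 2 * \<Xi> * (D * M) * (2 * L)"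
  have C: "C > 0" unfolding C_def using D M L \<Xi> by (intro add_pos_pos mult_pos_pos) auto
  \<comment> \<open>The first bound makes the integral equation contracting and keeps
    \<open>Y\<close> between 1/2 and \<open>M\<close>; the factor \<open>\<Xi> + 1\<close> covers
    the estimates with \<Xi> and with 1 together. The second bound makes the Lipschitz constant of
    \<open>R\<close> at most \<eta>.\<close>
  define \<epsilon> where "\<epsilon> = min (1 / (4 * ((\<Xi> + 1) * (D * M)))) (\<eta> / (D * C))"
  have \<epsilon>: "\<epsilon> > 0" unfolding \<epsilon>_def min_less_iff_conj
    using D M \<Xi> \<eta> C by (intro conjI divide_pos_pos mult_pos_pos) auto
  have "(\<Xi> + 1) * (D * M) > 0" using D M \<Xi> by (intro mult_pos_pos) auto
  moreover have "\<epsilon> \<le> 1 / (4 * ((\<Xi> + 1) * (D * M)))" by (simp add: \<epsilon>_def)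
  moreover have "e * k \<le> 1/4" if "k > 0" "e \<le> 1 / (4 * k)" for e k :: real
    using that by (simp add: field_simps)
  ultimately have "\<epsilon> * ((\<Xi> + 1) * (D * M)) \<le> 1/4" by blast
  then have \<epsilon>M: "2 * \<epsilon> * (\<Xi> + 1) * (D * M) \<le> 1/2" by simp
  have "\<epsilon> \<le> \<eta> / (D * C)" by (simp add: \<epsilon>_def)
  then have \<epsilon>C: "\<epsilon> * (D * C) \<le> \<eta>" using D C by (simp add: field_simps)
  have "2 * \<epsilon> * \<Xi> * (D * M) \<le> 2 * \<epsilon> * (\<Xi> + 1) * (D * M)"
    using \<epsilon> D M by (intro mult_right_mono mult_left_mono) auto
  then have \<epsilon>M1: "2 * \<epsilon> * \<Xi> * (D * M) \<le> 1/2" using \<epsilon>M by linarith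
  have "2 * \<epsilon> * 1 * (D * M) \<le> 2 * \<epsilon> * (\<Xi> + 1) * (D * M)"
    using \<epsilon> \<Xi> D M by (intro mult_right_mono mult_left_mono) auto
  then have \<epsilon>M2: "2 * \<epsilon> * (D * M) \<le> 1/2" using \<epsilon>M by linarith
  have \<epsilon>M3: "2 * \<epsilon> * \<Xi> * D \<le> 1/2"
  proof -
    have "2 * \<epsilon> * \<Xi> * (D * 1) \<le> 2 * \<epsilon> * \<Xi> * (D * M)"
      using \<epsilon> \<Xi> D M by (intro mult_left_mono) auto
    then show ?thesis using \<epsilon>M1 by simp
  qed

  \<comment> \<open>The clamping makes \<open>\<phi>\<close> globally Lipschitz and is inactive on the solutions, see \<open>\<phi>Y\<close> below.\<close>
  define \<phi> where "\<phi> = (\<lambda>y. sqrt (max (1/2) (min M y)))"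
  have \<phi>_lip: "\<bar>\<phi> a - \<phi> b\<bar> \<le> \<bar>a - b\<bar>" for a b
  proof -
    have "\<bar>\<phi> a - \<phi> b\<bar> \<le> \<bar>max (1/2) (min M a) - max (1/2) (min M b)\<bar>"
      unfolding \<phi>_def by (intro abs_sqrt_diff_le) auto
    then show ?thesis by linarith
  qed
  have \<phi>_bd: "0 \<le> \<phi> a" "\<phi> a \<le> M" for a
  proof -
    have "\<phi> a \<le> sqrt M" unfolding \<phi>_def using M by simp
    also have "\<dots> \<le> sqrt (M\<^sup>2)"
      using M by (intro real_sqrt_le_mono self_le_power) auto
    finally show "\<phi> a \<le> M" using M by simp
  qed (simp add: \<phi>_def)
  have "1-lipschitz_on UNIV \<phi>"
    by (rule lipschitz_onI) (auto simp: dist_real_def \<phi>_lip)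
  then have \<phi>_cont: "continuous_on UNIV \<phi>" by (rule lipschitz_on_continuous_on)

  have "\<forall>\<xi>\<in>{-\<Xi>..\<Xi>}. \<exists>Y. continuous_on {-T..T} Y \<and> (\<forall>t\<in>{-T..T}.
      Y t = (1 + 2 * \<xi>\<^sup>2 * q t) + (-2 * \<epsilon> * \<xi>) * integral {-T..t} (\<lambda>s. P s * \<phi> (Y s)))"
  proof (intro ballI volterra_fixed_point[OF _ P _ \<beta> \<phi>_lip])
    fix \<xi> assume "\<xi> \<in> {-\<Xi>..\<Xi>}"
    then have \<xi>: "\<bar>\<xi>\<bar> \<le> \<Xi>" by auto
    have "\<bar>-2 * \<epsilon> * \<xi>\<bar> * \<beta> * (T - - T) = 2 * \<epsilon> * \<bar>\<xi>\<bar> * D"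
      using \<epsilon> by (simp add: D_def abs_mult)
    also have "\<dots> \<le> 2 * \<epsilon> * \<Xi> * D"
      using \<epsilon> \<xi> D by (intro mult_left_mono mult_right_mono) auto
    finally show "\<bar>-2 * \<epsilon> * \<xi>\<bar> * \<beta> * (T - - T) \<le> 1/2" using \<epsilon>M3 by linarith
  qed (use T in \<open>auto intro!: continuous_intros q_cont\<close>)
  from bchoice[OF this] obtain Y where "\<forall>\<xi>\<in>{-\<Xi>..\<Xi>}. continuous_on {-T..T} (Y \<xi>) \<and> (\<forall>t\<in>{-T..T}.
      Y \<xi> t = (1 + 2 * \<xi>\<^sup>2 * q t) + (-2 * \<epsilon> * \<xi>) * integral {-T..t} (\<lambda>s. P s * \<phi> (Y \<xi> s)))"
    by blast
  then have Y_cont: "continuous_on {-T..T} (Y \<xi>)"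
    and Y': "t \<in> {-T..T} \<Longrightarrow>
      Y \<xi> t = (1 + 2 * \<xi>\<^sup>2 * q t) + (-2 * \<epsilon> * \<xi>) * integral {-T..t} (\<lambda>s. P s * \<phi> (Y \<xi> s))"
    if "\<bar>\<xi>\<bar> \<le> \<Xi>" for \<xi> t
    using that by (auto simp: abs_le_iff)

  define I where "I = (\<lambda>\<xi> t. integral {-T..t} (\<lambda>s. P s * \<phi> (Y \<xi> s)))"
  \<comment> \<open>\<open>Z\<close> is the solution for \<epsilon> = 0, that is, for the center x'
    = sinh t x^3, where everything is explicit.\<close>
  define Z where "Z = (\<lambda>\<xi> t. 1 + 2 * \<xi>\<^sup>2 * q t)"
  have Y: "Y \<xi> t = Z \<xi> t - 2 * \<epsilon> * \<xi> * I \<xi> t" if "\<bar>\<xi>\<bar> \<le> \<Xi>" "t \<in> {-T..T}" for \<xi> t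
    using Y'[OF that] by (simp add: I_def Z_def)
  have Z_cont: "continuous_on {-T..T} (Z \<xi>)" for \<xi>
    unfolding Z_def by (intro continuous_intros q_cont)
  have P\<phi>_cont: "continuous_on {-T..T} (\<lambda>s. P s * \<phi> (Y \<xi> s))" if "\<bar>\<xi>\<bar> \<le> \<Xi>" for \<xi>
    by (intro continuous_intros P continuous_on_compose2[OF \<phi>_cont Y_cont[OF that]]) auto
  have I_bd: "\<bar>I \<xi> t\<bar> \<le> D * M" if \<xi>: "\<bar>\<xi>\<bar> \<le> \<Xi>" and t: "t \<in> {-T..T}" for \<xi> t
  proof -
    have "\<bar>I \<xi> t\<bar> \<le> (\<beta> * M) * (T - - T)"
      unfolding I_def
    proof (rule integral_abs_bound[OF P\<phi>_cont[OF \<xi>] _ t])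
      fix s assume "s \<in> {-T..T}"
      then show "\<bar>P s * \<phi> (Y \<xi> s)\<bar> \<le> \<beta> * M"
        unfolding abs_mult using \<phi>_bd[of "Y \<xi> s"] \<beta>0 by (intro mult_mono \<beta>) auto
    qed
    then show ?thesis by (simp add: D_def algebra_simps)
  qed
  have Z_bd: "1 \<le> Z \<xi> t" "Z \<xi> t \<le> M - 1" if \<xi>: "\<bar>\<xi>\<bar> \<le> \<Xi>" and t: "t \<in> {-T..T}" for \<xi> t
  proof -
    have "\<xi>\<^sup>2 \<le> \<Xi>\<^sup>2" using abs_le_square_iff[of \<xi> \<Xi>] \<xi> \<Xi> by simp
    then have "\<xi>\<^sup>2 * q t \<le> \<Xi>\<^sup>2 * Q" using q[OF t] by (intro mult_mono) auto
    then show "Z \<xi> t \<le> M - 1" by (simp add: Z_def M_def)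
    show "1 \<le> Z \<xi> t" using q[OF t] by (simp add: Z_def)
  qed
  have E_bd: "\<bar>2 * \<epsilon> * \<xi> * I \<xi> t\<bar> \<le> \<epsilon> * (2 * \<Xi> * (D * M))"
    if \<xi>: "\<bar>\<xi>\<bar> \<le> \<Xi>" and t: "t \<in> {-T..T}" for \<xi> t
  proof -
    have "\<bar>2 * \<epsilon> * \<xi> * I \<xi> t\<bar> = 2 * \<epsilon> * (\<bar>\<xi>\<bar> * \<bar>I \<xi> t\<bar>)" using \<epsilon> by (simp add: abs_mult)
    also have "\<dots> \<le> 2 * \<epsilon> * (\<Xi> * (D * M))"
      using \<epsilon> \<xi> I_bd[OF \<xi> t] \<Xi> by (intro mult_left_mono mult_mono) auto
    finally show ?thesis by (simp add: algebra_simps)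
  qed
  have Y_bd: "1/2 \<le> Y \<xi> t" "Y \<xi> t \<le> M" if \<xi>: "\<bar>\<xi>\<bar> \<le> \<Xi>" and t: "t \<in> {-T..T}" for \<xi> t
  proof -
    have "\<epsilon> * (2 * \<Xi> * (D * M)) = 2 * \<epsilon> * \<Xi> * (D * M)" by simp
    then have "\<bar>2 * \<epsilon> * \<xi> * I \<xi> t\<bar> \<le> 1/2" using E_bd[OF that] \<epsilon>M1 by linarith
    then show "1/2 \<le> Y \<xi> t" "Y \<xi> t \<le> M"
      unfolding Y[OF that] using Z_bd[OF that] by linarith+
  qed
  have \<phi>Y: "\<phi> (Y \<xi> t) = sqrt (Y \<xi> t)" if \<xi>: "\<bar>\<xi>\<bar> \<le> \<Xi>" and t: "t \<in> {-T..T}" for \<xi> t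
    using Y_bd[OF that] by (simp add: \<phi>_def)

  have Z_lip: "\<bar>Z \<xi> t - Z \<zeta> t\<bar> \<le> 4 * \<Xi> * Q * \<bar>\<xi> - \<zeta>\<bar>"
    if "\<bar>\<xi>\<bar> \<le> \<Xi>" "\<bar>\<zeta>\<bar> \<le> \<Xi>" and t: "t \<in> {-T..T}" for \<xi> \<zeta> t
  proof -
    have "Z \<xi> t - Z \<zeta> t = 2 * ((\<xi> + \<zeta>) * q t * (\<xi> - \<zeta>))"
      by (simp add: Z_def power2_eq_square algebra_simps)
    then have "\<bar>Z \<xi> t - Z \<zeta> t\<bar> = 2 * (\<bar>\<xi> + \<zeta>\<bar> * q t * \<bar>\<xi> - \<zeta>\<bar>)"
      using q[OF t] by (simp only: abs_mult)
    also have "\<dots> \<le> 2 * ((2 * \<Xi>) * Q * \<bar>\<xi> - \<zeta>\<bar>)"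
      using that q[OF t] by (intro mult_left_mono mult_right_mono mult_mono) auto
    finally show ?thesis by simp
  qed
  have I_lip0: "\<bar>I \<xi> t - I \<zeta> t\<bar> \<le> D * w"
    if \<xi>: "\<bar>\<xi>\<bar> \<le> \<Xi>" and \<zeta>: "\<bar>\<zeta>\<bar> \<le> \<Xi>" and t: "t \<in> {-T..T}"
      and w: "\<And>s. s \<in> {-T..T} \<Longrightarrow> \<bar>Y \<xi> s - Y \<zeta> s\<bar> \<le> w" for \<xi> \<zeta> t w
  proof -
    have int: "(\<lambda>s. P s * \<phi> (Y \<xi> s)) integrable_on {-T..t}" if "\<bar>\<xi>\<bar> \<le> \<Xi>" for \<xi>
      using t by (intro integrable_continuous_real continuous_on_subset[OF P\<phi>_cont[OF that]]) auto
    have "I \<xi> t - I \<zeta> t = integral {-T..t} (\<lambda>s. P s * \<phi> (Y \<xi> s) - P s * \<phi> (Y \<zeta> s))"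
      unfolding I_def by (rule integral_diff[symmetric, OF int[OF \<xi>] int[OF \<zeta>]])
    also have "\<bar>\<dots>\<bar> \<le> (\<beta> * w) * (T - - T)"
    proof (rule integral_abs_bound[OF _ _ t])
      show "continuous_on {-T..T} (\<lambda>s. P s * \<phi> (Y \<xi> s) - P s * \<phi> (Y \<zeta> s))"
        by (intro continuous_on_diff P\<phi>_cont \<xi> \<zeta>)
      fix s assume s: "s \<in> {-T..T}"
      have "\<bar>P s * \<phi> (Y \<xi> s) - P s * \<phi> (Y \<zeta> s)\<bar> = \<bar>P s\<bar> * \<bar>\<phi> (Y \<xi> s) - \<phi> (Y \<zeta> s)\<bar>"
        by (simp add: abs_mult[symmetric] algebra_simps)
      also have "\<dots> \<le> \<beta> * w"
        using order_trans[OF \<phi>_lip w[OF s]] \<beta>0 by (intro mult_mono \<beta> s) auto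
      finally show "\<bar>P s * \<phi> (Y \<xi> s) - P s * \<phi> (Y \<zeta> s)\<bar> \<le> \<beta> * w" .
    qed
    finally show ?thesis by (simp add: D_def algebra_simps)
  qed
  \<comment> \<open>The bound \<open>w\<close> is left free because the estimate is used twice:
    first with the still unknown maximal distance of \<open>Y \<xi>\<close> and
    \<open>Y \<zeta>\<close>, then with the Lipschitz bound obtained from it.\<close>
  have E_lip0: "\<bar>2 * \<epsilon> * \<xi> * I \<xi> t - 2 * \<epsilon> * \<zeta> * I \<zeta> t\<bar> \<le>
      2 * \<epsilon> * (D * M) * \<bar>\<xi> - \<zeta>\<bar> + 2 * \<epsilon> * \<Xi> * D * w"
    if \<xi>: "\<bar>\<xi>\<bar> \<le> \<Xi>" and \<zeta>: "\<bar>\<zeta>\<bar> \<le> \<Xi>" and t: "t \<in> {-T..T}"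
      and w: "\<And>s. s \<in> {-T..T} \<Longrightarrow> \<bar>Y \<xi> s - Y \<zeta> s\<bar> \<le> w" for \<xi> \<zeta> t w
  proof -
    have "2 * \<epsilon> * \<xi> * I \<xi> t - 2 * \<epsilon> * \<zeta> * I \<zeta> t =
        2 * \<epsilon> * (I \<xi> t * (\<xi> - \<zeta>) + \<zeta> * (I \<xi> t - I \<zeta> t))"
      by (simp add: algebra_simps)
    then have "\<bar>2 * \<epsilon> * \<xi> * I \<xi> t - 2 * \<epsilon> * \<zeta> * I \<zeta> t\<bar> =
        2 * \<epsilon> * \<bar>I \<xi> t * (\<xi> - \<zeta>) + \<zeta> * (I \<xi> t - I \<zeta> t)\<bar>"
      using \<epsilon> by (simp add: abs_mult)
    also have "\<dots> \<le> 2 * \<epsilon> * (\<bar>I \<xi> t\<bar> * \<bar>\<xi> - \<zeta>\<bar> + \<bar>\<zeta>\<bar> * \<bar>I \<xi> t - I \<zeta> t\<bar>)"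
      using \<epsilon> abs_triangle_ineq[of "I \<xi> t * (\<xi> - \<zeta>)" "\<zeta> * (I \<xi> t - I \<zeta> t)"]
      by (intro mult_left_mono) (auto simp: abs_mult)
    also have "\<dots> \<le> 2 * \<epsilon> * ((D * M) * \<bar>\<xi> - \<zeta>\<bar> + \<Xi> * (D * w))"
      using \<epsilon> I_bd[OF \<xi> t] I_lip0[OF that] \<Xi> \<zeta>
      by (intro mult_left_mono add_mono mult_right_mono mult_mono) auto
    finally show ?thesis by (simp add: algebra_simps)
  qed
  have Y_lip: "\<bar>Y \<xi> t - Y \<zeta> t\<bar> \<le> L * \<bar>\<xi> - \<zeta>\<bar>"
    if \<xi>: "\<bar>\<xi>\<bar> \<le> \<Xi>" and \<zeta>: "\<bar>\<zeta>\<bar> \<le> \<Xi>" and t: "t \<in> {-T..T}" for \<xi> \<zeta> t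
  proof -
    \<comment> \<open>At a point of maximal distance \<open>w\<close>, the integral equation bounds
      \<open>w\<close> by a multiple of \<open>\<bar>\<xi> - \<zeta>\<bar>\<close> plus
      \<open>w / 2\<close>. Absorbing the last term doubles the remaining constants, which gives
      \<open>L\<close>.\<close>
    have "\<exists>s\<in>{-T..T}. \<forall>t\<in>{-T..T}. \<bar>Y \<xi> t - Y \<zeta> t\<bar> \<le> \<bar>Y \<xi> s - Y \<zeta> s\<bar>"
      using T by (intro continuous_attains_sup continuous_intros Y_cont \<xi> \<zeta>) auto
    then obtain s where s: "s \<in> {-T..T}"
      and w: "\<And>t. t \<in> {-T..T} \<Longrightarrow> \<bar>Y \<xi> t - Y \<zeta> t\<bar> \<le> \<bar>Y \<xi> s - Y \<zeta> s\<bar>" by blast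
    define w where "w = \<bar>Y \<xi> s - Y \<zeta> s\<bar>"
    have "w = \<bar>(Z \<xi> s - Z \<zeta> s) - (2 * \<epsilon> * \<xi> * I \<xi> s - 2 * \<epsilon> * \<zeta> * I \<zeta> s)\<bar>"
      unfolding w_def Y[OF \<xi> s] Y[OF \<zeta> s] by (simp add: algebra_simps)
    also have "\<dots> \<le> \<bar>Z \<xi> s - Z \<zeta> s\<bar> + \<bar>2 * \<epsilon> * \<xi> * I \<xi> s - 2 * \<epsilon> * \<zeta> * I \<zeta> s\<bar>"
      by (rule abs_triangle_ineq4)
    also have "\<dots> \<le> 4 * \<Xi> * Q * \<bar>\<xi> - \<zeta>\<bar> + (2 * \<epsilon> * (D * M) * \<bar>\<xi> - \<zeta>\<bar> + 2 * \<epsilon> * \<Xi> * D * w)"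
      unfolding w_def by (intro add_mono Z_lip E_lip0 \<xi> \<zeta> s w)
    also have "2 * \<epsilon> * (D * M) * \<bar>\<xi> - \<zeta>\<bar> \<le> 1/2 * \<bar>\<xi> - \<zeta>\<bar>"
      by (intro mult_right_mono \<epsilon>M2) auto
    also have "2 * \<epsilon> * \<Xi> * D * w \<le> 1/2 * w"
      by (intro mult_right_mono \<epsilon>M3) (auto simp: w_def)
    finally have "w \<le> L * \<bar>\<xi> - \<zeta>\<bar>" by (simp add: L_def algebra_simps)
    then show ?thesis using w[OF t] by (simp add: w_def)
  qed
  define G where "G = (\<lambda>\<xi> t. sqrt (Y \<xi> t) - sqrt (Z \<xi> t))"
  have G_lip: "\<bar>G \<xi> t - G \<zeta> t\<bar> \<le> \<epsilon> * C * \<bar>\<xi> - \<zeta>\<bar>"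
    if \<xi>: "\<bar>\<xi>\<bar> \<le> \<Xi>" and \<zeta>: "\<bar>\<zeta>\<bar> \<le> \<Xi>" and t: "t \<in> {-T..T}" for \<xi> \<zeta> t
  proof -
    \<comment> \<open>Estimating the two roots of \<open>G\<close> separately would lose the factor
      \<epsilon>. Written as the quotient \<open>E / S\<close>, \<open>G\<close> has \<epsilon> in
      its numerator and a denominator at least 1.\<close>
    define S where "S = (\<lambda>\<xi>. sqrt (Y \<xi> t) + sqrt (Z \<xi> t))"
    define E where "E = (\<lambda>\<xi>. - (2 * \<epsilon> * \<xi> * I \<xi> t))"
    have S: "S \<xi> \<ge> 1" if "\<bar>\<xi>\<bar> \<le> \<Xi>" for \<xi>
      using Y_bd[OF that t] Z_bd[OF that t] by (simp add: S_def add_increasing)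
    have G: "G \<xi> t = E \<xi> / S \<xi>" if "\<bar>\<xi>\<bar> \<le> \<Xi>" for \<xi>
    proof -
      have "G \<xi> t * S \<xi> = (sqrt (Y \<xi> t))\<^sup>2 - (sqrt (Z \<xi> t))\<^sup>2"
        by (simp add: G_def S_def power2_eq_square algebra_simps)
      also have "\<dots> = E \<xi>"
        using Y_bd[OF that t] Z_bd[OF that t] Y[OF that t] by (simp add: E_def)
      finally show ?thesis using S[OF that] by (simp add: field_simps)
    qed
    have "\<bar>S \<xi> - S \<zeta>\<bar> \<le> \<bar>sqrt (Y \<xi> t) - sqrt (Y \<zeta> t)\<bar> + \<bar>sqrt (Z \<xi> t) - sqrt (Z \<zeta> t)\<bar>"
      unfolding S_def by linarith
    also have "\<dots> \<le> \<bar>Y \<xi> t - Y \<zeta> t\<bar> + \<bar>Z \<xi> t - Z \<zeta> t\<bar>"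
      using Y_bd[OF \<xi> t] Z_bd[OF \<xi> t] Y_bd[OF \<zeta> t] Z_bd[OF \<zeta> t]
      by (intro add_mono abs_sqrt_diff_le) auto
    also have "\<dots> \<le> L * \<bar>\<xi> - \<zeta>\<bar> + L * \<bar>\<xi> - \<zeta>\<bar>"
      using Y_lip[OF that] Z_lip[OF that] mult_right_mono[OF L(2), of "\<bar>\<xi> - \<zeta>\<bar>"] by linarith
    finally have S_lip: "\<bar>S \<xi> - S \<zeta>\<bar> \<le> 2 * L * \<bar>\<xi> - \<zeta>\<bar>" by simp
    have E_lip: "\<bar>E \<xi> - E \<zeta>\<bar> \<le> \<epsilon> * (2 * (D * M + \<Xi> * (D * L))) * \<bar>\<xi> - \<zeta>\<bar>"
      using E_lip0[OF \<xi> \<zeta> t Y_lip[OF \<xi> \<zeta>]] by (simp add: E_def algebra_simps)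
    have "\<bar>G \<xi> t - G \<zeta> t\<bar> \<le> \<bar>E \<xi> - E \<zeta>\<bar> + \<bar>E \<zeta>\<bar> * \<bar>S \<xi> - S \<zeta>\<bar>"
      unfolding G[OF \<xi>] G[OF \<zeta>] by (intro abs_quotient_diff_le S \<xi> \<zeta>)
    also have "\<dots> \<le> \<epsilon> * (2 * (D * M + \<Xi> * (D * L))) * \<bar>\<xi> - \<zeta>\<bar> +
        (\<epsilon> * (2 * \<Xi> * (D * M))) * (2 * L * \<bar>\<xi> - \<zeta>\<bar>)"
      using E_bd[OF \<zeta> t] \<epsilon> \<Xi> D M by (intro add_mono mult_mono E_lip S_lip) (auto simp: E_def)
    finally show ?thesis by (simp add: C_def algebra_simps)
  qed
  have PY_cont: "continuous_on {-T..T} (\<lambda>t. P t * sqrt (Y \<xi> t))" if "\<bar>\<xi>\<bar> \<le> \<Xi>" for \<xi>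
    by (intro continuous_intros P Y_cont that)
  have PZ_cont: "continuous_on {-T..T} (\<lambda>t. P t * sqrt (Z \<xi> t))" for \<xi>
    by (intro continuous_intros P Z_cont)
  have PG_cont: "continuous_on {-T..T} (\<lambda>t. P t * G \<xi> t)" if "\<bar>\<xi>\<bar> \<le> \<Xi>" for \<xi>
    unfolding G_def by (intro continuous_intros P Y_cont Z_cont that)
  define R where "R = (\<lambda>\<xi>. integral {-T..T} (\<lambda>t. P t * G \<xi> t))"
  have TT: "T \<in> {-T..T}" "-T \<in> {-T..T}" using T by auto

  have "R 0 = 0"
  proof -
    have "R 0 = integral {-T..T} (\<lambda>t. 0)"
      unfolding R_def by (rule integral_cong) (use Y[of 0] \<Xi> in \<open>simp add: G_def\<close>)
    then show ?thesis by simp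
  qed
  moreover have "\<bar>R \<xi> - R \<zeta>\<bar> \<le> \<eta> * \<bar>\<xi> - \<zeta>\<bar>" if "\<xi> \<in> {-\<Xi>..\<Xi>}" "\<zeta> \<in> {-\<Xi>..\<Xi>}" for \<xi> \<zeta>
  proof -
    have \<xi>: "\<bar>\<xi>\<bar> \<le> \<Xi>" and \<zeta>: "\<bar>\<zeta>\<bar> \<le> \<Xi>" using that by auto
    have "R \<xi> - R \<zeta> = integral {-T..T} (\<lambda>t. P t * G \<xi> t - P t * G \<zeta> t)"
      unfolding R_def by (intro integral_diff[symmetric] integrable_continuous_real PG_cont \<xi> \<zeta>)
    also have "\<bar>\<dots>\<bar> \<le> (\<beta> * (\<epsilon> * C * \<bar>\<xi> - \<zeta>\<bar>)) * (T - - T)"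
    proof (rule integral_abs_bound[OF _ _ TT(1)])
      show "continuous_on {-T..T} (\<lambda>s. P s * G \<xi> s - P s * G \<zeta> s)"
        by (intro continuous_on_diff PG_cont \<xi> \<zeta>)
      fix s assume s: "s \<in> {-T..T}"
      have "\<bar>P s * G \<xi> s - P s * G \<zeta> s\<bar> = \<bar>P s\<bar> * \<bar>G \<xi> s - G \<zeta> s\<bar>"
        by (simp add: abs_mult[symmetric] algebra_simps)
      also have "\<dots> \<le> \<beta> * (\<epsilon> * C * \<bar>\<xi> - \<zeta>\<bar>)"
        using \<beta>0 by (intro mult_mono \<beta> s G_lip \<xi> \<zeta>) auto
      finally show "\<bar>P s * G \<xi> s - P s * G \<zeta> s\<bar> \<le> \<beta> * (\<epsilon> * C * \<bar>\<xi> - \<zeta>\<bar>)" .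
    qed
    also have "\<dots> = (\<epsilon> * (D * C)) * \<bar>\<xi> - \<zeta>\<bar>" by (simp add: D_def)
    also have "\<dots> \<le> \<eta> * \<bar>\<xi> - \<zeta>\<bar>" by (intro mult_right_mono \<epsilon>C) auto
    finally show ?thesis .
  qed
  moreover have "\<exists>x. abel_solution T sinh (\<lambda>t. \<epsilon> * P t) x \<and> x (-T) = \<xi> \<and>
      (x T = \<xi> \<longleftrightarrow> \<xi> * (integral {-T..T} (\<lambda>t. P t * sqrt (Z \<xi> t)) + R \<xi>) = 0)"
    if "\<xi> \<in> {-\<Xi>..\<Xi>}" for \<xi>
  proof -
    have \<xi>: "\<bar>\<xi>\<bar> \<le> \<Xi>" using that by auto
    define x where "x = restrict (\<lambda>t. \<xi> / sqrt (Y \<xi> t)) {-T..T}"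
    have "abel_solution T sinh (\<lambda>t. \<epsilon> * P t) x"
      unfolding abel_solution_def
    proof (intro conjI ballI)
      fix t assume t: "t \<in> {-T..T}"
      define s where "s = sqrt (Y \<xi> t)"
      have Yp: "Y \<xi> t > 0" using Y_bd[OF \<xi> t] by simp
      then have s: "s > 0" by (simp add: s_def)
      have "((\<lambda>t. Z \<xi> t - 2 * \<epsilon> * \<xi> * I \<xi> t) has_real_derivative
          - (2 * \<xi>\<^sup>2 * sinh t) - 2 * \<epsilon> * \<xi> * (P t * \<phi> (Y \<xi> t))) (at t within {-T..T})"
        unfolding Z_def q_def I_def
        by (rule derivative_eq_intros refl integral_has_real_derivative[OF P\<phi>_cont[OF \<xi>] t])+ simp
      then have dY: "(Y \<xi> has_real_derivative
          - (2 * \<xi>\<^sup>2 * sinh t) - 2 * \<epsilon> * \<xi> * (P t * s)) (at t within {-T..T})"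
        unfolding s_def \<phi>Y[OF \<xi> t] has_field_derivative_def
        by (rule has_derivative_transform[OF t, rotated]) (simp add: Y \<xi>)
      \<comment> \<open>Multiplying this factor by the derivative of \<open>Y\<close> turns its two
        summands into the cubic and the quadratic term of the Abel equation for \<xi> /
        \<open>s\<close>.\<close>
      have "((\<lambda>y. \<xi> / sqrt y) has_real_derivative - \<xi> / (2 * s ^ 3)) (at (Y \<xi> t))"
        using Yp s by (auto intro!: derivative_eq_intros simp: s_def power2_eq_square power3_eq_cube field_simps)
      from DERIV_chain2[OF this dY]
      have "((\<lambda>t. \<xi> / sqrt (Y \<xi> t)) has_real_derivative
          sinh t * (\<xi> / s) ^ 3 + \<epsilon> * P t * (\<xi> / s) ^ 2) (at t within {-T..T})"
        by (rule DERIV_cong) (use s in \<open>simp add: field_simps power2_eq_square power3_eq_cube\<close>)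
      then have "(x has_real_derivative
          sinh t * (\<xi> / s) ^ 3 + \<epsilon> * P t * (\<xi> / s) ^ 2) (at t within {-T..T})"
        unfolding has_field_derivative_def
        by (rule has_derivative_transform[OF t, rotated]) (simp add: x_def)
      then show "(x has_real_derivative sinh t * x t ^ 3 + \<epsilon> * P t * x t ^ 2) (at t within {-T..T})"
        using t by (simp add: x_def s_def)
    qed (simp add: x_def)
    moreover have "x (-T) = \<xi>"
      using Y[OF \<xi> TT(2)] TT(2) by (simp add: x_def Z_def q_def I_def)
    moreover have "x T = \<xi> \<longleftrightarrow> \<xi> * (integral {-T..T} (\<lambda>t. P t * sqrt (Z \<xi> t)) + R \<xi>) = 0"
    proof -
      have "I \<xi> T = integral {-T..T} (\<lambda>t. P t * sqrt (Y \<xi> t))"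
        unfolding I_def by (rule integral_cong) (simp add: \<phi>Y \<xi>)
      also have "\<dots> = integral {-T..T} (\<lambda>t. P t * sqrt (Z \<xi> t) + P t * G \<xi> t)"
        by (rule integral_cong) (simp add: G_def algebra_simps)
      also have "\<dots> = integral {-T..T} (\<lambda>t. P t * sqrt (Z \<xi> t)) + R \<xi>"
        unfolding R_def by (intro integral_add integrable_continuous_real PZ_cont PG_cont \<xi>)
      finally have I_eq: "I \<xi> T = integral {-T..T} (\<lambda>t. P t * sqrt (Z \<xi> t)) + R \<xi>" .
      \<comment> \<open>Here the oddness of \<open>sinh\<close> enters: its primitive gives a
        \<open>q\<close> that vanishes at both end points. Hence \<open>Y\<close> returns to 1
        exactly when \<open>\<xi> * I \<xi> T\<close> is zero.\<close>
      have "Y \<xi> T = 1 - 2 * \<epsilon> * \<xi> * I \<xi> T"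
        using Y[OF \<xi> TT(1)] by (simp add: Z_def q_def)
      moreover have "x T = \<xi> / sqrt (Y \<xi> T)" using TT by (simp add: x_def)
      moreover have "\<xi> / sqrt (Y \<xi> T) = \<xi> \<longleftrightarrow> \<xi> = 0 \<or> Y \<xi> T = 1"
        using Y_bd[OF \<xi> TT(1)] by (auto simp: field_simps)
      ultimately show ?thesis using \<epsilon> by (auto simp: I_eq[symmetric])
    qed
    ultimately show ?thesis by blast
  qed
  ultimately show ?thesis unfolding Z_def q_def by (intro exI[of _ \<epsilon>] exI[of _ R]) auto
qed

section \<open>Prescribing the limiting integral\<close>

text \<open>The derivative of the remainder is itself the Taylor remainder of (1 + 2 y)^(-1/2), one
  order lower, so it is at most a constant times y^m; the mean value inequality gives the Lipschitz
  bound. The coefficients must be nonzero because prescribed coefficients will be divided by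
  them.\<close>

lemma sqrt_taylor:
  "\<exists>a C. 0 \<le> C \<and> a 0 = 1 \<and> (\<forall>k. a k \<noteq> 0) \<and>
    (\<forall>u y z. 0 \<le> y \<longrightarrow> y \<le> u \<longrightarrow> 0 \<le> z \<longrightarrow> z \<le> u \<longrightarrow>
      \<bar>(sqrt (1 + 2 * y) - (\<Sum>k\<le>m. a k * y ^ k)) - (sqrt (1 + 2 * z) - (\<Sum>k\<le>m. a k * z ^ k))\<bar>
        \<le> C * u ^ m * \<bar>y - z :: real\<bar>)"
proof -
  \<comment> \<open>\<open>D k\<close> is the \<open>k\<close>-th derivative of (1 + 2 y)^(-1/2),
    the derivative of sqrt (1 + 2 y), and \<open>d k\<close> is its value at 0. Integrating that
    Taylor series termwise gives the coefficients \<open>a\<close>.\<close>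
  define d :: "nat \<Rightarrow> real" where "d = (\<lambda>k. \<Prod>j<k. - (1 + 2 * real j))"
  define D where "D = (\<lambda>k y. d k * (1 + 2 * y) powr (- 1/2 - real k))"
  define a where "a = (\<lambda>k. case k of 0 \<Rightarrow> 1 | Suc k \<Rightarrow> d k / (fact k * real (Suc k)))"
  have d_nz: "d k \<noteq> 0" for k by (simp add: d_def)
  have a_nz: "a k \<noteq> 0" for k by (cases k) (simp_all add: a_def d_nz del: of_nat_Suc)
  have D_deriv: "(D k has_real_derivative D (Suc k) y) (at y)" if "y \<ge> 0" for k y
  proof -
    have lin: "((\<lambda>y. 1 + 2 * y) has_real_derivative 2) (at y)"
      by (auto intro!: derivative_eq_intros)
    have "((\<lambda>z. z powr (- 1/2 - real k)) has_real_derivative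
        (- 1/2 - real k) * (1 + 2 * y) powr (- 1/2 - real k - 1)) (at (1 + 2 * y))"
      using that by (intro has_real_derivative_powr) auto
    from DERIV_cmult[OF DERIV_chain2[OF this lin], of "d k"] show ?thesis
      unfolding D_def
    proof (rule DERIV_cong)
      have "d (Suc k) = d k * ((- 1/2 - real k) * 2)" by (simp add: d_def)
      moreover have "- 1/2 - real (Suc k) = - 1/2 - real k - 1" by simp
      ultimately show "d k * ((- 1/2 - real k) * (1 + 2 * y) powr (- 1/2 - real k - 1) * 2) =
          d (Suc k) * (1 + 2 * y) powr (- 1/2 - real (Suc k))"
        by (simp only: mult_ac)
    qed
  qed
  have D_bd: "\<bar>D k y\<bar> \<le> \<bar>d k\<bar>" if "y \<ge> 0" for k y
  proof -
    have "(1 + 2 * y) powr (- 1/2 - real k) \<le> (1 + 2 * y) powr 0"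
      using that by (intro powr_mono) auto
    then have "(1 + 2 * y) powr (- 1/2 - real k) \<le> 1" using that by simp
    then have "\<bar>d k\<bar> * (1 + 2 * y) powr (- 1/2 - real k) \<le> \<bar>d k\<bar> * 1"
      by (intro mult_left_mono) auto
    then show ?thesis by (simp add: D_def abs_mult)
  qed
  have D_0: "D k 0 = d k" for k by (simp add: D_def)
  define r where "r = (\<lambda>y. sqrt (1 + 2 * y) - (\<Sum>k\<le>m. a k * y ^ k))"
  define r' where "r' = (\<lambda>y. D 0 y - (\<Sum>k<m. d k / fact k * y ^ k))"
  have r'_bd: "\<bar>r' y\<bar> \<le> \<bar>d m\<bar> * y ^ m" if "y \<ge> 0" for y
  \<comment> \<open>\<open>Maclaurin\<close> requires a positive order and a positive point, so the
    degenerate cases are treated separately.\<close>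
  proof (cases "m = 0 \<or> y = 0")
    case True
    then show ?thesis
    proof
      assume "m = 0"
      then show ?thesis using D_bd[OF that, of 0] by (simp add: r'_def)
    next
      assume y: "y = 0"
      show ?thesis
      proof (cases m)
        case 0
        then show ?thesis using D_bd[OF that, of 0] by (simp add: r'_def)
      next
        case (Suc l)
        have "(\<Sum>k<m. d k / fact k * y ^ k) = d 0"
          unfolding Suc sum.lessThan_Suc_shift by (simp add: y)
        then show ?thesis using y by (simp add: r'_def D_0)
      qed
    qed
  next
    case False
    then have y: "y > 0" and m: "m > 0" using that by auto
    have "\<exists>t>0. t < y \<and> D 0 y = (\<Sum>k<m. D k 0 / fact k * y ^ k) + D m t / fact m * y ^ m"
      by (rule Maclaurin[OF y m refl]) (simp add: D_deriv)
    then obtain t where t: "0 < t" "t < y"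
      and "D 0 y = (\<Sum>k<m. D k 0 / fact k * y ^ k) + D m t / fact m * y ^ m"
      by blast
    then have "r' y = D m t / fact m * y ^ m" by (simp add: r'_def D_0)
    also have "\<bar>\<dots>\<bar> = \<bar>D m t\<bar> / fact m * y ^ m" using y by (simp add: abs_mult)
    also have "\<dots> \<le> \<bar>d m\<bar> / 1 * y ^ m"
      using y t D_bd[of t m] fact_ge_1[of m] by (intro mult_right_mono frac_le) auto
    finally show ?thesis by simp
  qed
  have r_deriv: "(r has_real_derivative r' y) (at y)" if "y \<ge> 0" for y
  proof -
    have poly: "(\<lambda>y. \<Sum>k\<le>m. a k * y ^ k) = (\<lambda>y. 1 + (\<Sum>k<m. a (Suc k) * y ^ Suc k))"
      by (simp add: a_def sum.atMost_shift)
    have "((\<lambda>y. \<Sum>k<m. a (Suc k) * y ^ Suc k) has_real_derivative (\<Sum>k<m. d k / fact k * y ^ k)) (at y)"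
    proof (rule DERIV_sum)
      fix k
      have "((\<lambda>y. a (Suc k) * y ^ Suc k) has_real_derivative a (Suc k) * (real (Suc k) * y ^ k)) (at y)"
        by (rule derivative_eq_intros refl)+ simp
      then show "((\<lambda>y. a (Suc k) * y ^ Suc k) has_real_derivative d k / fact k * y ^ k) (at y)"
        by (rule DERIV_cong) (simp add: a_def del: of_nat_Suc)
    qed
    moreover have "((\<lambda>y. sqrt (1 + 2 * y)) has_real_derivative D 0 y) (at y)"
    proof -
      have lin: "((\<lambda>y. 1 + 2 * y) has_real_derivative 2) (at y)"
        by (auto intro!: derivative_eq_intros)
      have "(1 + 2 * y) powr (- (1 / 2)) = inverse (sqrt (1 + 2 * y))"
        using that by (simp only: powr_minus) (simp add: powr_half_sqrt)
      then have "inverse (sqrt (1 + 2 * y)) / 2 * 2 = D 0 y"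
        by (simp add: D_def d_def)
      moreover have "(sqrt has_real_derivative inverse (sqrt (1 + 2 * y)) / 2) (at (1 + 2 * y))"
        using that by (intro DERIV_real_sqrt) simp
      ultimately show ?thesis using DERIV_cong[OF DERIV_chain2[OF _ lin]] by blast
    qed
    ultimately have "((\<lambda>y. sqrt (1 + 2 * y) - (1 + (\<Sum>k<m. a (Suc k) * y ^ Suc k)))
        has_real_derivative D 0 y - (0 + (\<Sum>k<m. d k / fact k * y ^ k))) (at y)"
      by (intro DERIV_diff DERIV_add DERIV_const)
    then show ?thesis using fun_cong[OF poly] by (simp only: r_def r'_def) simp
  qed
  have "\<bar>r y - r z\<bar> \<le> \<bar>d m\<bar> * u ^ m * \<bar>y - z\<bar>" if "0 \<le> y" "y \<le> u" "0 \<le> z" "z \<le> u" for u y z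
  proof -
    have "norm (r y - r z) \<le> (\<bar>d m\<bar> * u ^ m) * norm (y - z)"
    proof (rule field_differentiable_bound[where S = "{0..u}"])
      fix x assume x: "x \<in> {0..u}"
      show "(r has_real_derivative r' x) (at x within {0..u})"
        by (rule has_field_derivative_at_within[OF r_deriv]) (use x in simp)
      have "\<bar>d m\<bar> * x ^ m \<le> \<bar>d m\<bar> * u ^ m" using x by (intro mult_left_mono power_mono) auto
      then show "norm (r' x) \<le> \<bar>d m\<bar> * u ^ m" using r'_bd[of x] x by auto
    qed (use that in auto)
    then show ?thesis by simp
  qed
  moreover have "a 0 = 1" by (simp add: a_def)
  ultimately show ?thesis
    using a_nz abs_ge_zero[of "d m"] unfolding r_def by blast
qed

section \<open>Dual families of independent vectors\<close>

text \<open>Induction on the number of rows, in the manner of Gram-Schmidt: a vector killed by the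
  old rows but not by the new one is normalised, and multiples of it are subtracted from the old
  dual vectors to make the new row vanish on them.\<close>

lemma dual_vectors:
  fixes g :: "nat \<Rightarrow> 'j \<Rightarrow> real"
  assumes J: "finite J"
    and indep: "\<And>c. (\<And>j. j \<in> J \<Longrightarrow> (\<Sum>k<n. c k * g k j) = 0) \<Longrightarrow> \<forall>k<n. c k = 0"
  shows "\<exists>v. \<forall>i<n. \<forall>k<n. (\<Sum>j\<in>J. v i j * g k j) = (if i = k then 1 else 0)"
  using indep
proof (induction n)
  case (Suc n)
  have "\<forall>k<n. c k = 0" if c: "\<And>j. j \<in> J \<Longrightarrow> (\<Sum>k<n. c k * g k j) = 0" for c
  proof -
    have "\<forall>k<Suc n. (if k < n then c k else 0) = 0"
      by (rule Suc.prems) (simp add: c)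
    then show ?thesis by (metis less_SucI)
  qed
  then obtain v where v: "\<And>i k. i < n \<Longrightarrow> k < n \<Longrightarrow> (\<Sum>j\<in>J. v i j * g k j) = (if i = k then 1 else 0)"
    using Suc.IH by blast
  define l where "l = (\<lambda>k (w :: 'j \<Rightarrow> real). \<Sum>j\<in>J. w j * g k j)"
  have l_diff: "l k (\<lambda>j. w j - w' j) = l k w - l k w'" for k w w'
    by (simp add: l_def sum_subtractf algebra_simps)
  have l_scale: "l k (\<lambda>j. c * w j) = c * l k w" for k c w
    by (simp add: l_def sum_distrib_left algebra_simps)
  have l_sum: "l k (\<lambda>j. \<Sum>i<n. w i j) = (\<Sum>i<n. l k (w i))" for k and w :: "nat \<Rightarrow> 'j \<Rightarrow> real"
    unfolding l_def by (subst sum.swap) (simp add: sum_distrib_right)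
  have v: "l k (v i) = (if i = k then 1 else 0)" if "i < n" "k < n" for i k
    using v[OF that] by (simp add: l_def)
  \<comment> \<open>Otherwise row \<open>n\<close> would be a combination of the earlier rows,
    against their independence.\<close>
  have "\<exists>j\<in>J. g n j - (\<Sum>i<n. l n (v i) * g i j) \<noteq> 0"
  proof (rule ccontr)
    assume "\<not> ?thesis"
    then have "\<forall>k<Suc n. (if k < n then - l n (v k) else 1) = 0"
      by (intro Suc.prems) (simp add: sum_negf)
    then show False by auto
  qed
  then obtain j0 where j0: "j0 \<in> J" "g n j0 - (\<Sum>i<n. l n (v i) * g i j0) \<noteq> 0" by blast
  \<comment> \<open>The unit vector at \<open>j0\<close> minus its components along the old dual
    vectors: all old rows kill it, and row \<open>n\<close> takes on it the nonzero value found
    above.\<close>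
  define w where "w = (\<lambda>j. (if j = j0 then 1 else 0) - (\<Sum>i<n. g i j0 * v i j))"
  have l_w: "l k w = g k j0 - (\<Sum>i<n. g i j0 * l k (v i))" for k
  proof -
    have "l k (\<lambda>j. if j = j0 then 1 else 0) = g k j0"
      unfolding l_def using J j0 by (simp add: if_distrib[of "\<lambda>x. x * _"] sum.delta cong: if_cong)
    then show ?thesis unfolding w_def by (simp only: l_diff l_sum l_scale)
  qed
  have w0: "l k w = 0" if "k < n" for k
    unfolding l_w using that by (simp add: v if_distrib[of "\<lambda>x. _ * x"] sum.delta cong: if_cong)
  have wn: "l n w \<noteq> 0" using j0 by (simp add: l_w mult.commute)
  define u where "u = (\<lambda>j. (1 / l n w) * w j)"
  have u: "l k u = (if k = n then 1 else 0)" if "k \<le> n" for k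
    unfolding u_def l_scale using w0[of k] wn that by auto
  define v' where "v' = (\<lambda>i. if i < n then (\<lambda>j. v i j - l n (v i) * u j) else u)"
  have "l k (v' i) = (if i = k then 1 else 0)" if "i < Suc n" "k < Suc n" for i k
    using that v[of i k] u[of k] by (auto simp: v'_def l_diff l_scale less_Suc_eq)
  then show ?case unfolding l_def by blast
qed simp

section \<open>Closure properties of hyperbolic polynomials\<close>

lemma hyperbolic_poly_add:
  assumes "f \<in> hyperbolic_poly n" "g \<in> hyperbolic_poly n"
  shows "(\<lambda>t. f t + g t) \<in> hyperbolic_poly n"
proof -
  obtain a b where f: "\<And>t. f t = a 0 + (\<Sum>i=1..n. a i * cosh (real i * t) + b i * sinh (real i * t))"
    using assms(1) unfolding hyperbolic_poly_def by auto
  obtain c d where g: "\<And>t. g t = c 0 + (\<Sum>i=1..n. c i * cosh (real i * t) + d i * sinh (real i * t))"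
    using assms(2) unfolding hyperbolic_poly_def by auto
  show ?thesis unfolding hyperbolic_poly_def f g
    by (intro CollectI exI[of _ "\<lambda>i. a i + c i"] exI[of _ "\<lambda>i. b i + d i"])
      (simp add: sum.distrib algebra_simps)
qed

lemma hyperbolic_poly_scale:
  assumes "f \<in> hyperbolic_poly n"
  shows "(\<lambda>t. c * f t) \<in> hyperbolic_poly n"
proof -
  obtain a b where f: "\<And>t. f t = a 0 + (\<Sum>i=1..n. a i * cosh (real i * t) + b i * sinh (real i * t))"
    using assms(1) unfolding hyperbolic_poly_def by auto
  show ?thesis unfolding hyperbolic_poly_def f
    by (intro CollectI exI[of _ "\<lambda>i. c * a i"] exI[of _ "\<lambda>i. c * b i"])
      (simp add: sum_distrib_left algebra_simps)
qed

lemma hyperbolic_poly_cosh: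
  assumes "k \<le> n"
  shows "(\<lambda>t. cosh (real k * t)) \<in> hyperbolic_poly n"
  unfolding hyperbolic_poly_def
  by (intro CollectI exI[of _ "\<lambda>i. if i = k then 1 else 0"] exI[of _ "\<lambda>i. 0"])
    (use assms in \<open>auto simp: if_distrib[of "\<lambda>x. x * _"] sum.delta cong: if_cong\<close>)

lemma hyperbolic_poly_sinh:
  assumes "k \<le> n"
  shows "(\<lambda>t. sinh (real k * t)) \<in> hyperbolic_poly n"
  unfolding hyperbolic_poly_def
  by (intro CollectI exI[of _ "\<lambda>i. if i = k then 1 else 0"] exI[of _ "\<lambda>i. 0"]
        exI[of _ "\<lambda>i. if i = k then 1 else 0"])
    (use assms in \<open>auto simp: if_distrib[of "\<lambda>x. x * _"] sum.delta cong: if_cong\<close>)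

lemma hyperbolic_poly_const: "(\<lambda>t. c) \<in> hyperbolic_poly n"
  using hyperbolic_poly_scale[OF hyperbolic_poly_cosh[of 0 n], of c] by simp

lemma hyperbolic_poly_sum:
  assumes "\<And>i. i \<in> I \<Longrightarrow> f i \<in> hyperbolic_poly n"
  shows "(\<lambda>t. \<Sum>i\<in>I. f i t) \<in> hyperbolic_poly n"
  using assms
  by (induction I rule: infinite_finite_induct)
    (auto intro: hyperbolic_poly_const hyperbolic_poly_add)

lemma hyperbolic_poly_mono:
  assumes "f \<in> hyperbolic_poly n" "n \<le> m"
  shows "f \<in> hyperbolic_poly m"
proof -
  obtain a b where f: "\<And>t. f t = a 0 + (\<Sum>i=1..n. a i * cosh (real i * t) + b i * sinh (real i * t))"
    using assms(1) unfolding hyperbolic_poly_def by auto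
  have "(\<lambda>t. a 0 + (\<Sum>i=1..n. a i * cosh (real i * t) + b i * sinh (real i * t))) \<in> hyperbolic_poly m"
    using assms(2)
    by (intro hyperbolic_poly_add hyperbolic_poly_const hyperbolic_poly_sum
        hyperbolic_poly_scale hyperbolic_poly_cosh hyperbolic_poly_sinh) auto
  moreover have "f = (\<lambda>t. a 0 + (\<Sum>i=1..n. a i * cosh (real i * t) + b i * sinh (real i * t)))"
    by (rule ext) (rule f)
  ultimately show ?thesis by (simp only:)
qed

text \<open>The product-to-sum formulas move the frequency i to i + 1 and i - 1, so the degree grows
  by at most one. Iterating this puts powers of the shifted \<open>cosh\<close> into the coefficient
  space.\<close>

lemma hyperbolic_poly_cosh_mult:
  assumes "f \<in> hyperbolic_poly n"
  shows "(\<lambda>t. cosh t * f t) \<in> hyperbolic_poly (Suc n)"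
proof -
  obtain a b where f: "\<And>t. f t = a 0 + (\<Sum>i=1..n. a i * cosh (real i * t) + b i * sinh (real i * t))"
    using assms(1) unfolding hyperbolic_poly_def by auto
  \<comment> \<open>The condition \<open>i \<ge> 1\<close> keeps the natural number subtraction
    \<open>i - 1\<close> from being truncated. The constant term is handled separately, as a
    multiple of \<open>cosh (real 1 * t)\<close>.\<close>
  have cosh_i: "cosh t * cosh (real i * t) =
      1/2 * cosh (real (i + 1) * t) + 1/2 * cosh (real (i - 1) * t)"
    and sinh_i: "cosh t * sinh (real i * t) =
      1/2 * sinh (real (i + 1) * t) + 1/2 * sinh (real (i - 1) * t)" if "i \<ge> 1" for i t
  proof -
    have *: "real (i + 1) * t = real i * t + t" "real (i - 1) * t = real i * t - t"
      using that by (simp_all add: of_nat_diff algebra_simps)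
    show "cosh t * cosh (real i * t) =
        1/2 * cosh (real (i + 1) * t) + 1/2 * cosh (real (i - 1) * t)"
      and "cosh t * sinh (real i * t) =
        1/2 * sinh (real (i + 1) * t) + 1/2 * sinh (real (i - 1) * t)"
      unfolding * cosh_add cosh_diff sinh_add sinh_diff by (simp_all add: algebra_simps)
  qed
  have termwise: "a i * (cosh t * cosh (real i * t)) + b i * (cosh t * sinh (real i * t)) =
      a i * (1/2 * cosh (real (i + 1) * t) + 1/2 * cosh (real (i - 1) * t)) +
      b i * (1/2 * sinh (real (i + 1) * t) + 1/2 * sinh (real (i - 1) * t))" if "i \<in> {1..n}" for i t
  proof -
    have "i \<ge> 1" using that by simp
    then show ?thesis by (simp only: cosh_i sinh_i)
  qed
  have eq: "(\<lambda>t. cosh t * f t) = (\<lambda>t. a 0 * cosh (real 1 * t) + (\<Sum>i=1..n.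
      a i * (1/2 * cosh (real (i + 1) * t) + 1/2 * cosh (real (i - 1) * t)) +
      b i * (1/2 * sinh (real (i + 1) * t) + 1/2 * sinh (real (i - 1) * t))))"
  proof
    fix t
    have "cosh t * f t = a 0 * cosh (real 1 * t) + (\<Sum>i=1..n.
        a i * (cosh t * cosh (real i * t)) + b i * (cosh t * sinh (real i * t)))"
      by (simp add: f sum_distrib_left algebra_simps)
    also have "\<dots> = a 0 * cosh (real 1 * t) + (\<Sum>i=1..n.
      a i * (1/2 * cosh (real (i + 1) * t) + 1/2 * cosh (real (i - 1) * t)) +
      b i * (1/2 * sinh (real (i + 1) * t) + 1/2 * sinh (real (i - 1) * t)))"
      by (intro arg_cong2[of _ _ _ _ "(+)"] sum.cong termwise refl)
    finally show "cosh t * f t = \<dots>" .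
  qed
  show ?thesis unfolding eq
    by (intro hyperbolic_poly_add hyperbolic_poly_const hyperbolic_poly_sum
        hyperbolic_poly_scale hyperbolic_poly_cosh hyperbolic_poly_sinh) auto
qed

lemma hyperbolic_poly_power: "(\<lambda>t. (c - cosh t) ^ k) \<in> hyperbolic_poly k"
proof (induction k)
  case 0
  show ?case by (simp add: hyperbolic_poly_const)
next
  case (Suc k)
  have "(\<lambda>t. c * (c - cosh t) ^ k + (- 1) * (cosh t * (c - cosh t) ^ k)) \<in> hyperbolic_poly (Suc k)"
    by (intro hyperbolic_poly_add hyperbolic_poly_scale hyperbolic_poly_cosh_mult Suc
        hyperbolic_poly_mono[OF Suc]) simp
  then show ?case by (simp add: algebra_simps)
qed

lemma hyperbolic_poly_continuous_on:
  assumes "f \<in> hyperbolic_poly n"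
  shows "continuous_on S f"
proof -
  obtain a b where "\<forall>t. f t = a 0 + (\<Sum>i=1..n. a i * cosh (real i * t) + b i * sinh (real i * t))"
    using assms unfolding hyperbolic_poly_def by auto
  then have f: "f = (\<lambda>t. a 0 + (\<Sum>i=1..n. a i * cosh (real i * t) + b i * sinh (real i * t)))"
    by (intro ext) simp
  show ?thesis unfolding f by (intro continuous_intros)
qed

section \<open>Moments and the Gram matrix of powers\<close>

text \<open>The Gram matrix of the powers of \<open>q\<close> has trivial kernel: a kernel vector
  would give a polynomial in \<open>q\<close> whose square has integral zero, hence a polynomial
  vanishing at the infinitely many values of \<open>q\<close>. \<open>dual_vectors\<close> then
  produces the dual polynomials.\<close>

lemma moment_dual:
  fixes q :: "real \<Rightarrow> real"
  assumes q: "continuous_on {l..r} q" and inf: "infinite (q ` {l..r})"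
  shows "\<exists>v. \<forall>i\<le>m. \<forall>k\<le>m.
    integral {l..r} (\<lambda>t. (\<Sum>j\<le>m. v i j * q t ^ j) * q t ^ k) = (if i = k then 1 else 0)"
proof -
  have "l < r"
  proof (rule ccontr)
    assume "\<not> l < r"
    then have "{l..r} \<subseteq> {l}" by auto
    then have "finite (q ` {l..r})" using finite_subset by blast
    then show False using inf by simp
  qed
  define \<mu> where "\<mu> = (\<lambda>i. integral {l..r} (\<lambda>t. q t ^ i))"
  have moment: "integral {l..r} (\<lambda>t. (\<Sum>j\<le>m. a j * q t ^ j) * q t ^ k) = (\<Sum>j\<le>m. a j * \<mu> (k + j))" for a k
  proof -
    have "integral {l..r} (\<lambda>t. (\<Sum>j\<le>m. a j * q t ^ j) * q t ^ k) =
        integral {l..r} (\<lambda>t. \<Sum>j\<le>m. a j * (q t ^ j * q t ^ k))"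
      by (simp only: sum_distrib_right mult.assoc)
    also have "\<dots> = (\<Sum>j\<le>m. integral {l..r} (\<lambda>t. a j * (q t ^ j * q t ^ k)))"
      by (rule integral_sum) (auto intro!: integrable_continuous_real continuous_intros q)
    finally show ?thesis by (simp add: \<mu>_def power_add mult.commute)
  qed
  have "\<exists>v. \<forall>i<Suc m. \<forall>k<Suc m. (\<Sum>j\<in>{..m}. v i j * \<mu> (k + j)) = (if i = k then 1 else 0)"
  proof (rule dual_vectors)
    fix c assume c: "\<And>j. j \<in> {..m} \<Longrightarrow> (\<Sum>k<Suc m. c k * \<mu> (k + j)) = 0"
    \<comment> \<open>The assumption on \<open>c\<close> says that \<open>f\<close> is orthogonal to
      every power of \<open>q\<close> up to \<open>m\<close>. Since \<open>f\<close> is a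
      combination of these powers, it is orthogonal to itself.\<close>
    define f where "f = (\<lambda>t. \<Sum>k\<le>m. c k * q t ^ k)"
    have f: "continuous_on {l..r} f" unfolding f_def by (intro continuous_intros q)
    have ft: "f t = (\<Sum>k\<le>m. c k * q t ^ k)" for t by (simp only: f_def)
    have ff: "f t * f t = (\<Sum>k\<le>m. c k * (f t * q t ^ k))" for t
      by (subst (2) ft) (simp only: sum_distrib_left mult.left_commute)
    have fq: "integral {l..r} (\<lambda>t. f t * q t ^ k) = (\<Sum>j\<le>m. c j * \<mu> (k + j))" for k
      unfolding f_def by (rule moment)
    have "integral {l..r} (\<lambda>t. f t * f t) = integral {l..r} (\<lambda>t. \<Sum>k\<le>m. c k * (f t * q t ^ k))"
      by (simp only: ff)
    also have "\<dots> = (\<Sum>k\<le>m. integral {l..r} (\<lambda>t. c k * (f t * q t ^ k)))"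
      by (intro integral_sum integrable_continuous_real continuous_intros q f) simp
    also have "\<dots> = (\<Sum>k\<le>m. c k * (\<Sum>j\<le>m. c j * \<mu> (k + j)))"
      by (simp only: integral_mult_right fq)
    also have "\<dots> = 0"
    proof (rule sum.neutral, rule ballI)
      fix k assume "k \<in> {..m}"
      from c[OF this] have "(\<Sum>j\<le>m. c j * \<mu> (k + j)) = 0"
        by (simp add: lessThan_Suc_atMost add.commute)
      then show "c k * (\<Sum>j\<le>m. c j * \<mu> (k + j)) = 0" by simp
    qed
    finally have "integral {l..r} (\<lambda>t. f t * f t) = 0" .
    then have "\<forall>t\<in>{l..r}. f t * f t = 0"
      using integral_eq_0_iff[OF continuous_on_mult[OF f f] \<open>l < r\<close>] by simp
    then have "q ` {l..r} \<subseteq> {x. (\<Sum>k\<le>m. c k * x ^ k) = 0}" by (auto simp: f_def)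
    then have "infinite {x. (\<Sum>k\<le>m. c k * x ^ k) = 0}" using inf finite_subset by blast
    then have "\<not> (\<exists>i\<le>m. c i \<noteq> 0)" using polyfun_finite_roots[of c m] by blast
    then show "\<forall>k<Suc m. c k = 0" by (simp add: less_Suc_eq_le)
  qed simp
  then obtain v where "\<forall>i<Suc m. \<forall>k<Suc m. (\<Sum>j\<in>{..m}. v i j * \<mu> (k + j)) = (if i = k then 1 else 0)" ..
  then show ?thesis unfolding moment less_Suc_eq_le by blast
qed

text \<open>Expanding the root in powers of (\<sigma> \<tau>)^2 \<open>q\<close> leaves moments of
  \<open>P\<close>, which the dual polynomials allow to be prescribed. All main terms then have the
  common factor \<sigma>^(2 m), while the Taylor remainder is smaller by a further factor
  \<sigma>^2. This is why the scaled variable \<tau> is used.\<close>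

lemma melnikov_prescribed:
  fixes T r \<eta> :: real and e :: "nat \<Rightarrow> real"
  assumes T: "T > 0" and r: "r > 0" and \<eta>: "\<eta> > 0"
  shows "\<exists>\<sigma>>0. \<exists>P\<in>hyperbolic_poly m. \<exists>R. R 0 = 0 \<and>
    (\<forall>x\<in>{-r..r}. \<forall>y\<in>{-r..r}. \<bar>R x - R y\<bar> \<le> \<eta> * \<bar>x - y\<bar>) \<and>
    (\<forall>\<tau>. integral {-T..T} (\<lambda>t. P t * sqrt (1 + 2 * (\<sigma> * \<tau>)\<^sup>2 * (cosh T - cosh t))) =
      \<sigma> ^ (2 * m) * ((\<Sum>k\<le>m. e k * \<tau> ^ (2 * k)) + R \<tau>))"
proof -
  define q where "q = (\<lambda>t. cosh T - cosh t)"
  define Q where "Q = cosh T"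
  have q: "0 \<le> q t" "q t \<le> Q" if "t \<in> {-T..T}" for t
    using cosh_diff_bounds[OF that] by (auto simp: q_def Q_def)
  have Q: "Q > 0" by (simp add: Q_def)
  have q_cont: "continuous_on S q" for S unfolding q_def by (intro continuous_intros)
  have "inj_on q {0..T}"
    by (rule inj_onI) (simp add: q_def)
  then have "infinite (q ` {0..T})" using T by (simp add: finite_image_iff infinite_Icc)
  moreover have "q ` {0..T} \<subseteq> q ` {-T..T}" using T by (intro image_mono) auto
  ultimately have "infinite (q ` {-T..T})" using finite_subset by blast
  from moment_dual[OF q_cont this, of m] obtain v where v: "\<And>i k. i \<le> m \<Longrightarrow> k \<le> m \<Longrightarrow>
    integral {-T..T} (\<lambda>t. (\<Sum>j\<le>m. v i j * q t ^ j) * q t ^ k) = (if i = k then 1 else 0)" by blast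
  define W where "W = (\<lambda>i t. \<Sum>j\<le>m. v i j * q t ^ j)"
  have W_cont: "continuous_on S (W i)" for S i unfolding W_def by (intro continuous_intros q_cont)
  have W_hyp: "W i \<in> hyperbolic_poly m" for i
    unfolding W_def q_def
    by (intro hyperbolic_poly_sum hyperbolic_poly_scale hyperbolic_poly_mono[OF hyperbolic_poly_power]) auto
  obtain a C where C: "0 \<le> C" and a: "a 0 = 1" "\<And>k. a k \<noteq> 0"
    and taylor: "\<And>u y z. 0 \<le> y \<Longrightarrow> y \<le> u \<Longrightarrow> 0 \<le> z \<Longrightarrow> z \<le> u \<Longrightarrow>
      \<bar>(sqrt (1 + 2 * y) - (\<Sum>k\<le>m. a k * y ^ k)) - (sqrt (1 + 2 * z) - (\<Sum>k\<le>m. a k * z ^ k))\<bar>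
        \<le> C * u ^ m * \<bar>y - z :: real\<bar>"
    using sqrt_taylor[of m] by blast
  have "\<exists>\<beta>. \<forall>t\<in>{-T..T}. \<bar>W i t\<bar> \<le> \<beta>" for i
    using compact_imp_bounded[OF compact_continuous_image[OF W_cont compact_Icc], of i "-T" T]
    by (auto simp: bounded_iff)
  then obtain \<beta> where \<beta>: "\<And>i t. t \<in> {-T..T} \<Longrightarrow> \<bar>W i t\<bar> \<le> \<beta> i" by metis
  have TT: "T \<in> {-T..T}" using T by auto
  have \<beta>0: "0 \<le> \<beta> i" for i using \<beta>[OF TT, of i] by linarith
  define K where "K = (\<Sum>i\<le>m. \<bar>e i / a i\<bar> * \<beta> i)"
  have K: "K \<ge> 0" unfolding K_def by (intro sum_nonneg mult_nonneg_nonneg \<beta>0) auto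
  \<comment> \<open>The Lipschitz constant of \<open>R\<close> will come out as \<sigma>^2 times
    \<open>c\<close>, with \<open>c\<close> independent of \<sigma>.\<close>
  define c where "c = K * (C * (r\<^sup>2 * Q) ^ m * (2 * r * Q)) * (T - - T)"
  have c: "c \<ge> 0" unfolding c_def using K C r Q T by (intro mult_nonneg_nonneg) auto
  \<comment> \<open>The bound 1 makes the estimate \<open>K\<close> of \<open>P\<close> uniform in
    \<sigma>. Dividing by \<open>c + 1\<close> instead of \<open>c\<close> covers the possible case
    \<open>c = 0\<close>.\<close>
  define \<sigma> where "\<sigma> = min 1 (\<eta> / (c + 1))"
  have \<sigma>: "0 < \<sigma>" "\<sigma> \<le> 1" using \<eta> c by (auto simp: \<sigma>_def)
  have "\<sigma> * (c + 1) \<le> \<eta>" using c by (simp add: \<sigma>_def pos_le_divide_eq[symmetric])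
  moreover have "\<sigma>\<^sup>2 * c \<le> \<sigma> * (c + 1)"
    unfolding power2_eq_square mult.assoc
    using \<sigma> c mult_right_mono[OF \<sigma>(2), of c] by (intro mult_left_mono) auto
  ultimately have \<sigma>c: "\<sigma>\<^sup>2 * c \<le> \<eta>" by linarith
  \<comment> \<open>By duality, the moment of \<open>P\<close> against the \<open>k\<close>-th power
    of \<open>q\<close> is the \<open>k\<close>-th weight. Its power of \<sigma> complements the
    \<sigma>^(2 k) of the expansion to \<sigma>^(2 m), and the quotient cancels the Taylor
    coefficient.\<close>
  define P where "P = (\<lambda>t. \<Sum>i\<le>m. (\<sigma> ^ (2 * (m - i)) * (e i / a i)) * W i t)"
  have P_hyp: "P \<in> hyperbolic_poly m"
    unfolding P_def by (intro hyperbolic_poly_sum hyperbolic_poly_scale W_hyp)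
  have P_cont: "continuous_on S P" for S by (rule hyperbolic_poly_continuous_on[OF P_hyp])
  have P_bd: "\<bar>P t\<bar> \<le> K" if t: "t \<in> {-T..T}" for t
  proof -
    have "\<bar>P t\<bar> \<le> (\<Sum>i\<le>m. \<bar>(\<sigma> ^ (2 * (m - i)) * (e i / a i)) * W i t\<bar>)"
      unfolding P_def by (rule sum_abs)
    also have "\<dots> \<le> (\<Sum>i\<le>m. \<bar>e i / a i\<bar> * \<beta> i)"
    proof (rule sum_mono)
      fix i
      have "\<bar>\<sigma> ^ (2 * (m - i))\<bar> \<le> 1" using \<sigma> by (simp add: power_le_one)
      then have "\<bar>\<sigma> ^ (2 * (m - i))\<bar> * \<bar>e i / a i\<bar> \<le> 1 * \<bar>e i / a i\<bar>"
        by (intro mult_right_mono) auto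
      then show "\<bar>(\<sigma> ^ (2 * (m - i)) * (e i / a i)) * W i t\<bar> \<le> \<bar>e i / a i\<bar> * \<beta> i"
        unfolding abs_mult[of _ "W i t"] abs_mult[of "\<sigma> ^ _"] by (intro mult_mono \<beta> t) auto
    qed
    finally show ?thesis by (simp add: K_def)
  qed
  have P_moment: "integral {-T..T} (\<lambda>t. P t * q t ^ k) = \<sigma> ^ (2 * (m - k)) * (e k / a k)" if "k \<le> m" for k
  proof -
    have "integral {-T..T} (\<lambda>t. P t * q t ^ k) =
        integral {-T..T} (\<lambda>t. \<Sum>i\<le>m. (\<sigma> ^ (2 * (m - i)) * (e i / a i)) * (W i t * q t ^ k))"
      by (simp only: P_def sum_distrib_right mult.assoc)
    also have "\<dots> = (\<Sum>i\<le>m. integral {-T..T} (\<lambda>t. (\<sigma> ^ (2 * (m - i)) * (e i / a i)) * (W i t * q t ^ k)))"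
      by (intro integral_sum integrable_continuous_real continuous_on_mult continuous_on_const
          continuous_on_power q_cont W_cont) simp
    also have "\<dots> = (\<Sum>i\<le>m. (\<sigma> ^ (2 * (m - i)) * (e i / a i)) * (if i = k then 1 else 0))"
      by (rule sum.cong) (use v that in \<open>simp_all add: W_def\<close>)
    also have "\<dots> = \<sigma> ^ (2 * (m - k)) * (e k / a k)"
      using that by (simp add: if_distrib[of "\<lambda>x. _ * x"] sum.delta cong: if_cong)
    finally show ?thesis .
  qed
  define f where "f = (\<lambda>y. sqrt (1 + 2 * y) - (\<Sum>k\<le>m. a k * y ^ k))"
  have f_cont: "continuous_on S (\<lambda>t. f (x * q t))" for S x
    unfolding f_def by (intro continuous_intros q_cont)
  define J where "J = (\<lambda>\<tau>. integral {-T..T} (\<lambda>t. P t * f ((\<sigma> * \<tau>)\<^sup>2 * q t)))"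
  have Pf_cont: "continuous_on S (\<lambda>t. P t * f (x * q t))" for S x
    by (intro continuous_on_mult P_cont f_cont)
  have expand: "integral {-T..T} (\<lambda>t. P t * sqrt (1 + 2 * (\<sigma> * \<tau>)\<^sup>2 * q t)) =
      \<sigma> ^ (2 * m) * (\<Sum>k\<le>m. e k * \<tau> ^ (2 * k)) + J \<tau>" for \<tau>
  proof -
    define x where "x = (\<sigma> * \<tau>)\<^sup>2"
    have Pq_cont: "continuous_on S (\<lambda>t. a k * x ^ k * (P t * q t ^ k))" for S k
      by (intro continuous_on_mult continuous_on_const continuous_on_power P_cont q_cont)
    have split: "P t * sqrt (1 + 2 * x * q t) = (\<Sum>k\<le>m. a k * x ^ k * (P t * q t ^ k)) + P t * f (x * q t)" for t
    proof -
      have "(\<Sum>k\<le>m. a k * x ^ k * (P t * q t ^ k)) = P t * (\<Sum>k\<le>m. a k * (x * q t) ^ k)"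
        by (simp only: sum_distrib_left power_mult_distrib mult_ac)
      then show ?thesis by (simp only: f_def right_diff_distrib mult.assoc)
    qed
    have "integral {-T..T} (\<lambda>t. P t * sqrt (1 + 2 * x * q t)) =
        integral {-T..T} (\<lambda>t. (\<Sum>k\<le>m. a k * x ^ k * (P t * q t ^ k)) + P t * f (x * q t))"
      by (simp only: split)
    also have "\<dots> = integral {-T..T} (\<lambda>t. \<Sum>k\<le>m. a k * x ^ k * (P t * q t ^ k)) +
        integral {-T..T} (\<lambda>t. P t * f (x * q t))"
      by (intro integral_add integrable_continuous_real continuous_on_sum Pq_cont Pf_cont)
    also have "integral {-T..T} (\<lambda>t. \<Sum>k\<le>m. a k * x ^ k * (P t * q t ^ k)) =
        (\<Sum>k\<le>m. integral {-T..T} (\<lambda>t. a k * x ^ k * (P t * q t ^ k)))"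
      by (intro integral_sum integrable_continuous_real Pq_cont) simp
    also have "\<dots> = (\<Sum>k\<le>m. \<sigma> ^ (2 * m) * (e k * \<tau> ^ (2 * k)))"
    proof (rule sum.cong[OF refl])
      fix k assume "k \<in> {..m}"
      then have k: "k \<le> m" by simp
      then have "2 * m = 2 * k + 2 * (m - k)" by simp
      then have "\<sigma> ^ (2 * m) = \<sigma> ^ (2 * k) * \<sigma> ^ (2 * (m - k))" by (simp only: power_add)
      moreover have "x ^ k = \<sigma> ^ (2 * k) * \<tau> ^ (2 * k)"
        by (simp add: x_def power_mult power_mult_distrib)
      ultimately show "integral {-T..T} (\<lambda>t. a k * x ^ k * (P t * q t ^ k)) = \<sigma> ^ (2 * m) * (e k * \<tau> ^ (2 * k))"
        using a(2)[of k] by (simp add: P_moment[OF k])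
    qed
    finally show ?thesis by (simp add: J_def x_def sum_distrib_left)
  qed
  define R where "R = (\<lambda>\<tau>. J \<tau> / \<sigma> ^ (2 * m))"
  have "(\<Sum>k\<le>m. a k * 0 ^ k) = 1"
    using a(1) by (simp add: power_0_left if_distrib[of "\<lambda>x. _ * x"] sum.delta cong: if_cong)
  then have "J 0 = 0" by (simp add: J_def f_def)
  have J_lip: "\<bar>J x - J y\<bar> \<le> \<sigma> ^ (2 * m) * (\<eta> * \<bar>x - y\<bar>)" if x: "x \<in> {-r..r}" and y: "y \<in> {-r..r}" for x y
  proof -
    \<comment> \<open>An upper bound for all arguments of \<open>f\<close> that occur. In the Taylor
      estimate \<open>u ^ m\<close> supplies the factor \<sigma>^(2 m), and the difference of two
      arguments supplies the additional \<sigma>^2.\<close>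
    define u where "u = \<sigma>\<^sup>2 * (r\<^sup>2 * Q)"
    have sq: "(\<sigma> * z)\<^sup>2 * q t \<le> u" if "z \<in> {-r..r}" "t \<in> {-T..T}" for z t
    proof -
      have "z\<^sup>2 \<le> r\<^sup>2" using that r abs_le_square_iff[of z r] by (simp add: abs_le_iff)
      then have "\<sigma>\<^sup>2 * (z\<^sup>2 * q t) \<le> \<sigma>\<^sup>2 * (r\<^sup>2 * Q)"
        using q[OF that(2)] by (intro mult_left_mono mult_mono) auto
      then show ?thesis by (simp add: u_def power_mult_distrib mult_ac)
    qed
    have "J x - J y = integral {-T..T} (\<lambda>t. P t * f ((\<sigma> * x)\<^sup>2 * q t) - P t * f ((\<sigma> * y)\<^sup>2 * q t))"
      unfolding J_def by (intro integral_diff[symmetric] integrable_continuous_real Pf_cont)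
    also have "\<bar>\<dots>\<bar> \<le> (K * (C * u ^ m * (\<sigma>\<^sup>2 * (2 * r * Q) * \<bar>x - y\<bar>))) * (T - - T)"
    proof (rule integral_abs_bound[OF _ _ TT])
      show "continuous_on {-T..T} (\<lambda>t. P t * f ((\<sigma> * x)\<^sup>2 * q t) - P t * f ((\<sigma> * y)\<^sup>2 * q t))"
        by (intro continuous_on_diff Pf_cont)
      fix t assume t: "t \<in> {-T..T}"
      have "(\<sigma> * x)\<^sup>2 * q t - (\<sigma> * y)\<^sup>2 * q t = \<sigma>\<^sup>2 * (((x + y) * q t) * (x - y))"
        by (simp add: power2_eq_square algebra_simps)
      then have "\<bar>(\<sigma> * x)\<^sup>2 * q t - (\<sigma> * y)\<^sup>2 * q t\<bar> = \<sigma>\<^sup>2 * ((\<bar>x + y\<bar> * q t) * \<bar>x - y\<bar>)"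
        using q[OF t] by (simp add: abs_mult)
      also have "\<dots> \<le> \<sigma>\<^sup>2 * ((2 * r * Q) * \<bar>x - y\<bar>)"
        using x y r q[OF t] by (intro mult_left_mono mult_right_mono mult_mono) auto
      finally have diff: "\<bar>(\<sigma> * x)\<^sup>2 * q t - (\<sigma> * y)\<^sup>2 * q t\<bar> \<le> \<sigma>\<^sup>2 * (2 * r * Q) * \<bar>x - y\<bar>"
        by (simp only: mult.assoc)
      have "\<bar>f ((\<sigma> * x)\<^sup>2 * q t) - f ((\<sigma> * y)\<^sup>2 * q t)\<bar> \<le>
          C * u ^ m * \<bar>(\<sigma> * x)\<^sup>2 * q t - (\<sigma> * y)\<^sup>2 * q t\<bar>"
        unfolding f_def using q[OF t] by (intro taylor sq x y t) auto
      also have "\<dots> \<le> C * u ^ m * (\<sigma>\<^sup>2 * (2 * r * Q) * \<bar>x - y\<bar>)"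
        using C Q by (intro mult_left_mono diff mult_nonneg_nonneg) (auto simp: u_def)
      finally have "\<bar>P t\<bar> * \<bar>f ((\<sigma> * x)\<^sup>2 * q t) - f ((\<sigma> * y)\<^sup>2 * q t)\<bar> \<le>
          K * (C * u ^ m * (\<sigma>\<^sup>2 * (2 * r * Q) * \<bar>x - y\<bar>))"
        using K by (intro mult_mono P_bd t) auto
      then show "\<bar>P t * f ((\<sigma> * x)\<^sup>2 * q t) - P t * f ((\<sigma> * y)\<^sup>2 * q t)\<bar> \<le>
          K * (C * u ^ m * (\<sigma>\<^sup>2 * (2 * r * Q) * \<bar>x - y\<bar>))"
        by (simp only: right_diff_distrib[symmetric] abs_mult)
    qed
    also have "\<dots> = \<sigma> ^ (2 * m) * ((\<sigma>\<^sup>2 * c) * \<bar>x - y\<bar>)"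
    proof -
      have "u ^ m = \<sigma> ^ (2 * m) * (r\<^sup>2 * Q) ^ m" by (simp only: u_def power_mult_distrib power_mult)
      then show ?thesis by (simp only: c_def mult_ac)
    qed
    also have "\<dots> \<le> \<sigma> ^ (2 * m) * (\<eta> * \<bar>x - y\<bar>)"
      using \<sigma> by (intro mult_left_mono mult_right_mono \<sigma>c) auto
    finally show ?thesis .
  qed
  show ?thesis
  proof (intro exI[of _ \<sigma>] conjI \<sigma> bexI[OF _ P_hyp] exI[of _ R] ballI allI)
    show "R 0 = 0" by (simp add: R_def \<open>J 0 = 0\<close>)
    fix x y assume "x \<in> {-r..r}" "y \<in> {-r..r}"
    from J_lip[OF this] have "\<bar>J x - J y\<bar> / \<sigma> ^ (2 * m) \<le> \<eta> * \<bar>x - y\<bar>"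
      using \<sigma> by (simp add: pos_divide_le_eq mult.commute)
    then show "\<bar>R x - R y\<bar> \<le> \<eta> * \<bar>x - y\<bar>"
      using \<sigma> by (simp add: R_def diff_divide_distrib[symmetric] abs_divide)
  next
    fix \<tau>
    show "integral {-T..T} (\<lambda>t. P t * sqrt (1 + 2 * (\<sigma> * \<tau>)\<^sup>2 * (cosh T - cosh t))) =
      \<sigma> ^ (2 * m) * ((\<Sum>k\<le>m. e k * \<tau> ^ (2 * k)) + R \<tau>)"
      using expand[of \<tau>] \<sigma> by (simp add: q_def R_def distrib_left)
  qed
qed

section \<open>Persistence of simple roots\<close>

text \<open>By continuity \<open>s * h'\<close> exceeds half of \<open>\<bar>h' a\<bar>\<close> near
  \<open>a\<close>, where \<open>s\<close> is the sign of \<open>h' a\<close>, so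
  \<open>s * h\<close> minus a line of that slope is nondecreasing. Stating this for all small
  \<delta> lets one \<delta> serve finitely many roots.\<close>

lemma strict_slope_near_simple_root:
  fixes h h' :: "real \<Rightarrow> real"
  assumes h: "\<And>x. (h has_real_derivative h' x) (at x)"
    and cont: "isCont h' a" and nz: "h' a \<noteq> 0"
  shows "\<forall>\<^sub>F \<delta> in at_right 0. \<exists>\<kappa>>0. \<exists>s\<in>{-1, 1}.
    \<forall>x y. a - \<delta> \<le> x \<longrightarrow> x \<le> y \<longrightarrow> y \<le> a + \<delta> \<longrightarrow> \<kappa> * (y - x) \<le> s * (h y - h x)"
proof -
  define s where "s = sgn (h' a)"
  define \<kappa> where "\<kappa> = \<bar>h' a\<bar> / 2"
  have s: "s \<in> {-1, 1}" using nz by (auto simp: s_def sgn_real_def)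
  have \<kappa>: "\<kappa> > 0" using nz by (simp add: \<kappa>_def)
  have "((\<lambda>x. s * h' x) \<longlongrightarrow> s * h' a) (nhds a)"
    using cont by (intro tendsto_intros) (simp add: isCont_def tendsto_nhds_iff)
  moreover have "s * h' a = \<bar>h' a\<bar>" by (simp add: s_def abs_sgn mult.commute)
  then have "\<kappa> < s * h' a" using nz by (simp add: \<kappa>_def)
  ultimately have "\<forall>\<^sub>F x in nhds a. \<kappa> < s * h' x" by (rule order_tendstoD)
  then obtain d where d: "d > 0" "\<And>x. dist x a < d \<Longrightarrow> \<kappa> < s * h' x"
    unfolding eventually_nhds_metric by blast
  have "\<kappa> * (y - x) \<le> s * (h y - h x)"
    if "\<delta> < d" "a - \<delta> \<le> x" "x \<le> y" "y \<le> a + \<delta>" for \<delta> x y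
  proof -
    have "s * h x - \<kappa> * x \<le> s * h y - \<kappa> * y"
    proof (rule DERIV_nonneg_imp_nondecreasing[OF \<open>x \<le> y\<close>])
      fix z assume "x \<le> z" "z \<le> y"
      then have "\<kappa> < s * h' z" using that by (intro d) (auto simp: dist_real_def)
      moreover have "((\<lambda>z. s * h z - \<kappa> * z) has_real_derivative s * h' z - \<kappa>) (at z)"
        by (rule derivative_eq_intros h refl)+ simp
      ultimately show "\<exists>D. ((\<lambda>z. s * h z - \<kappa> * z) has_real_derivative D) (at z) \<and> 0 \<le> D"
        by (intro exI[of _ "s * h' z - \<kappa>"]) auto
    qed
    then show ?thesis by (simp add: algebra_simps)
  qed
  moreover have "\<forall>\<^sub>F \<delta> in at_right 0. \<delta> < d"
    by (rule eventually_at_rightI[OF _ d(1)]) auto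
  ultimately show ?thesis
    using s \<kappa> by (auto elim!: eventually_mono intro!: exI[of _ \<kappa>] bexI[of _ s])
qed

text \<open>At the end points \<open>s * h\<close> has size at least
  \<open>\<kappa> * \<delta>\<close>, which exceeds \<open>\<bar>R\<bar>\<close>, so the
  intermediate value theorem gives a root. Since \<eta> is below the slope \<kappa>,
  \<open>s * (h + R)\<close> is strictly increasing, so there is only one.\<close>

lemma unique_root_lipschitz_perturbation:
  fixes h :: "real \<Rightarrow> real"
  assumes \<delta>: "\<delta> > 0" and \<kappa>: "\<kappa> > 0" and s: "s \<in> {-1, 1}" and ha: "h a = 0"
    and slope: "\<And>x y. a - \<delta> \<le> x \<Longrightarrow> x \<le> y \<Longrightarrow> y \<le> a + \<delta> \<Longrightarrow> \<kappa> * (y - x) \<le> s * (h y - h x)"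
    and h: "continuous_on {a - \<delta>..a + \<delta>} h"
    and R: "\<And>x y. x \<in> {-r..r} \<Longrightarrow> y \<in> {-r..r} \<Longrightarrow> \<bar>R x - R y\<bar> \<le> \<eta> * \<bar>x - y\<bar>"
    and R0: "R 0 = 0" and r: "- r \<le> a - \<delta>" "a + \<delta> \<le> r"
    and \<eta>: "0 < \<eta>" "\<eta> < \<kappa>" "\<eta> * r < \<kappa> * \<delta>"
  shows "\<exists>!z. z \<in> {a - \<delta><..<a + \<delta>} \<and> h z + R z = (0::real)"
proof -
  define F where "F = (\<lambda>x. s * (h x + R x))"
  have ss: "\<bar>s\<bar> = 1" "s \<noteq> 0" using s by auto
  have "\<eta>-lipschitz_on {-r..r} R"
    by (rule lipschitz_onI) (use R \<eta>(1) in \<open>simp_all add: dist_real_def\<close>)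
  then have "continuous_on {-r..r} R" by (rule lipschitz_on_continuous_on)
  then have "continuous_on {a - \<delta>..a + \<delta>} R"
    by (rule continuous_on_subset) (use r in auto)
  then have F_cont: "continuous_on {a - \<delta>..a + \<delta>} F"
    unfolding F_def by (intro continuous_intros h)
  have R_bd: "\<bar>s * R x\<bar> < \<kappa> * \<delta>" if "x \<in> {-r..r}" for x
  proof -
    have "\<bar>R x - R 0\<bar> \<le> \<eta> * \<bar>x - 0\<bar>" using that by (intro R) auto
    then have "\<bar>R x\<bar> \<le> \<eta> * \<bar>x\<bar>" by (simp add: R0)
    also have "\<dots> \<le> \<eta> * r" using that \<eta> by (intro mult_left_mono) auto
    finally show ?thesis using \<eta> ss by (simp add: abs_mult)
  qed
  have F: "F x = s * h x + s * R x" for x by (simp add: F_def distrib_left)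
  have mem: "a - \<delta> \<in> {-r..r}" "a + \<delta> \<in> {-r..r}" using r \<delta> by auto
  have "\<kappa> * \<delta> \<le> - (s * h (a - \<delta>))" "\<kappa> * \<delta> \<le> s * h (a + \<delta>)"
    using slope[of "a - \<delta>" a] slope[of a "a + \<delta>"] \<delta> by (simp_all add: ha)
  then have F_neg: "F (a - \<delta>) < 0" and F_pos: "F (a + \<delta>) > 0"
    using R_bd[OF mem(1)] R_bd[OF mem(2)] unfolding F by linarith+
  have "\<exists>z\<ge>a - \<delta>. z \<le> a + \<delta> \<and> F z = 0"
    by (rule IVT'[OF _ _ _ F_cont]) (use F_neg F_pos \<delta> in simp_all)
  then obtain z where z: "a - \<delta> \<le> z" "z \<le> a + \<delta>" "F z = 0" by blast
  have inc: "F x < F y" if "a - \<delta> \<le> x" "x < y" "y \<le> a + \<delta>" for x y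
  proof -
    have "\<bar>s * (R y - R x)\<bar> \<le> \<eta> * (y - x)"
      using R[of y x] that r ss by (simp add: abs_mult)
    also have "\<dots> < \<kappa> * (y - x)" using \<eta> that by simp
    also have "\<dots> \<le> s * (h y - h x)" using that by (intro slope) auto
    finally have "\<bar>s * (R y - R x)\<bar> < s * (h y - h x)" .
    then have "\<bar>s * R y - s * R x\<bar> < s * h y - s * h x" by (simp only: right_diff_distrib)
    then show ?thesis unfolding F by linarith
  qed
  show ?thesis
  proof (rule ex1I)
    have "z \<noteq> a - \<delta>" "z \<noteq> a + \<delta>" using z F_neg F_pos by auto
    then show "z \<in> {a - \<delta><..<a + \<delta>} \<and> h z + R z = 0"
      using z ss by (auto simp: F_def)
    fix y assume "y \<in> {a - \<delta><..<a + \<delta>} \<and> h y + R y = 0"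
    then have "F y = F z" "a - \<delta> \<le> y" "y \<le> a + \<delta>" using z by (auto simp: F_def)
    then show "y = z" using inc[of y z] inc[of z y] z(1,2) by linarith
  qed
qed

text \<open>The order of the quantifiers matters: \<eta> depends on the roots only, and the
  perturbation \<open>R\<close> is constructed afterwards to meet it. The point 0 is included in the
  isolation claim because the zero solution is to be counted; no root lies near it, since
  \<open>h 0\<close> is nonzero and \<open>R 0\<close> is zero.\<close>

lemma isolated_roots_lipschitz_perturbation:
  fixes A :: "real set" and r :: real
  assumes A: "finite A" "A \<subseteq> {-r<..<r}" "0 \<notin> A" and r: "r > 0"
  defines "h \<equiv> \<lambda>x. \<Prod>a\<in>A. (x - a)"
  shows "\<exists>\<eta>>0. \<forall>R. R 0 = 0 \<longrightarrow>
    (\<forall>x\<in>{-r..r}. \<forall>y\<in>{-r..r}. \<bar>R x - R y\<bar> \<le> \<eta> * \<bar>x - y\<bar>) \<longrightarrow>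
    (\<exists>Z. finite Z \<and> card Z = card A \<and> 0 \<notin> Z \<and> Z \<subseteq> {-r<..<r} \<and> (\<forall>z\<in>Z. h z + R z = 0) \<and>
      (\<forall>z\<in>insert 0 Z. \<exists>e>0. \<forall>x. \<bar>x - z\<bar> < e \<longrightarrow> x \<noteq> z \<longrightarrow> h x + R x \<noteq> (0::real)))"
proof -
  define p where "p = (\<Prod>a\<in>A. [:- a, 1:])"
  have h: "h = poly p" by (auto simp: h_def p_def poly_prod fun_eq_iff)
  have dp: "(h has_real_derivative poly (pderiv p) x) (at x)" for x
    unfolding h by (rule poly_DERIV)
  have ha: "h a = 0" if "a \<in> A" for a using that A by (auto simp: h_def)
  \<comment> \<open>The roots are simple: in the derivative at \<open>a\<close>, only the term in
    which the factor of \<open>a\<close> is differentiated survives.\<close>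
  have nz: "poly (pderiv p) a \<noteq> 0" if a: "a \<in> A" for a
  proof -
    have "p = [:- a, 1:] * (\<Prod>b\<in>A - {a}. [:- b, 1:])"
      unfolding p_def using A(1) a by (rule prod.remove)
    then have "poly (pderiv p) a = (\<Prod>b\<in>A - {a}. a - b)"
      by (simp only: pderiv_mult) (simp add: pderiv_pCons poly_prod)
    then show ?thesis using A(1) by auto
  qed
  have h_cont: "continuous_on S h" for S unfolding h by (intro continuous_intros)

  have small: "\<forall>\<^sub>F \<delta> in at_right 0. \<delta> < d" if "d > 0" for d :: real
    by (rule eventually_at_rightI[OF _ that]) auto
  \<comment> \<open>One \<delta> for all roots: the slope estimates hold, and the intervals of
    radius \<delta> lie inside (-r, r), avoid 0 and are pairwise disjoint.\<close>
  have "\<forall>\<^sub>F \<delta> in at_right 0. 0 < \<delta> \<and>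
    (\<forall>a\<in>A. (\<exists>\<kappa>>0. \<exists>s\<in>{-1, 1}. \<forall>x y. a - \<delta> \<le> x \<longrightarrow> x \<le> y \<longrightarrow> y \<le> a + \<delta> \<longrightarrow>
          \<kappa> * (y - x) \<le> s * (h y - h x)) \<and>
        \<delta> < a + r \<and> \<delta> < r - a \<and> \<delta> < \<bar>a\<bar> \<and> (\<forall>b\<in>A - {a}. \<delta> < \<bar>a - b\<bar> / 2))"
    using A nz by (intro eventually_conj eventually_ball_finite ballI eventually_at_right_less small
        strict_slope_near_simple_root[OF dp]) auto
  from eventually_happens'[OF trivial_limit_at_right_real this]
  obtain \<delta> where \<delta>': "0 < \<delta> \<and>
    (\<forall>a\<in>A. (\<exists>\<kappa>>0. \<exists>s\<in>{-1, 1}. \<forall>x y. a - \<delta> \<le> x \<longrightarrow> x \<le> y \<longrightarrow> y \<le> a + \<delta> \<longrightarrow>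
          \<kappa> * (y - x) \<le> s * (h y - h x)) \<and>
        \<delta> < a + r \<and> \<delta> < r - a \<and> \<delta> < \<bar>a\<bar> \<and> (\<forall>b\<in>A - {a}. \<delta> < \<bar>a - b\<bar> / 2))" ..
  then have \<delta>: "\<delta> > 0"
    and slope: "\<And>a. a \<in> A \<Longrightarrow> \<exists>\<kappa>>0. \<exists>s\<in>{-1, 1}. \<forall>x y. a - \<delta> \<le> x \<longrightarrow> x \<le> y \<longrightarrow> y \<le> a + \<delta> \<longrightarrow>
          \<kappa> * (y - x) \<le> s * (h y - h x)"
    and \<delta>r: "\<And>a. a \<in> A \<Longrightarrow> \<delta> < a + r" "\<And>a. a \<in> A \<Longrightarrow> \<delta> < r - a" "\<And>a. a \<in> A \<Longrightarrow> \<delta> < \<bar>a\<bar>"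
    and sep: "\<And>a b. a \<in> A \<Longrightarrow> b \<in> A \<Longrightarrow> a \<noteq> b \<Longrightarrow> \<delta> < \<bar>a - b\<bar> / 2"
    by blast+

  \<comment> \<open>The slopes \<kappa> differ from root to root. As there are finitely many roots,
    one small \<eta> still suits all of them, uniformly in \<open>R\<close>.\<close>
  have "\<forall>\<^sub>F \<eta> in at_right 0. 0 < \<eta> \<and> (\<forall>a\<in>A. \<forall>R. R 0 = 0 \<longrightarrow>
    (\<forall>x\<in>{-r..r}. \<forall>y\<in>{-r..r}. \<bar>R x - R y\<bar> \<le> \<eta> * \<bar>x - y\<bar>) \<longrightarrow>
    (\<exists>!z. z \<in> {a - \<delta><..<a + \<delta>} \<and> h z + R z = 0))"
  proof (intro eventually_conj eventually_ball_finite ballI eventually_at_right_less A(1))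
    fix a assume a: "a \<in> A"
    obtain \<kappa> s where \<kappa>: "\<kappa> > 0" "s \<in> {-1, 1}"
      and sl: "\<And>x y. a - \<delta> \<le> x \<Longrightarrow> x \<le> y \<Longrightarrow> y \<le> a + \<delta> \<Longrightarrow> \<kappa> * (y - x) \<le> s * (h y - h x)"
      using slope[OF a] by blast
    have "\<forall>\<^sub>F \<eta> in at_right 0. 0 < \<eta> \<and> \<eta> < \<kappa> \<and> \<eta> < \<kappa> * \<delta> / r"
      using \<kappa> \<delta> r by (intro eventually_conj eventually_at_right_less small) auto
    then show "\<forall>\<^sub>F \<eta> in at_right 0. \<forall>R. R 0 = 0 \<longrightarrow>
      (\<forall>x\<in>{-r..r}. \<forall>y\<in>{-r..r}. \<bar>R x - R y\<bar> \<le> \<eta> * \<bar>x - y\<bar>) \<longrightarrow>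
      (\<exists>!z. z \<in> {a - \<delta><..<a + \<delta>} \<and> h z + R z = 0)"
    proof (rule eventually_mono, intro allI impI)
      fix \<eta> R
      assume \<eta>: "0 < \<eta> \<and> \<eta> < \<kappa> \<and> \<eta> < \<kappa> * \<delta> / r" and R: "R 0 = (0::real)"
        "\<forall>x\<in>{-r..r}. \<forall>y\<in>{-r..r}. \<bar>R x - R y\<bar> \<le> \<eta> * \<bar>x - y\<bar>"
      show "\<exists>!z. z \<in> {a - \<delta><..<a + \<delta>} \<and> h z + R z = 0"
      proof (rule unique_root_lipschitz_perturbation[where r = r and \<eta> = \<eta>])
        show "\<bar>R x - R y\<bar> \<le> \<eta> * \<bar>x - y\<bar>" if "x \<in> {-r..r}" "y \<in> {-r..r}" for x y
          using R(2) that by blast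
        show "\<eta> * r < \<kappa> * \<delta>" using \<eta> r by (simp add: pos_less_divide_eq)
        show "\<kappa> * (y - x) \<le> s * (h y - h x)" if "a - \<delta> \<le> x" "x \<le> y" "y \<le> a + \<delta>" for x y
          using that by (rule sl)
      qed (use \<eta> \<delta>r[OF a] in \<open>simp_all add: \<delta> \<kappa>(1) ha[OF a] h_cont R(1) \<kappa>(2)[simplified]\<close>)
    qed
  qed
  from eventually_happens'[OF trivial_limit_at_right_real this]
  obtain \<eta> where \<eta>': "0 < \<eta> \<and> (\<forall>a\<in>A. \<forall>R. R 0 = 0 \<longrightarrow>
    (\<forall>x\<in>{-r..r}. \<forall>y\<in>{-r..r}. \<bar>R x - R y\<bar> \<le> \<eta> * \<bar>x - y\<bar>) \<longrightarrow>
    (\<exists>!z. z \<in> {a - \<delta><..<a + \<delta>} \<and> h z + R z = 0))" ..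
  then have \<eta>: "\<eta> > 0" by simp
  from \<eta>' have ex1: "\<exists>!z. z \<in> {a - \<delta><..<a + \<delta>} \<and> h z + R z = 0"
    if "a \<in> A" "R 0 = 0" "\<forall>x\<in>{-r..r}. \<forall>y\<in>{-r..r}. \<bar>R x - R y\<bar> \<le> \<eta> * \<bar>x - y\<bar>" for a R
    using that by simp_all
  show ?thesis
  proof (intro exI[of _ \<eta>] conjI \<eta> allI impI)
    fix R :: "real \<Rightarrow> real"
    assume R0: "R 0 = 0" and R: "\<forall>x\<in>{-r..r}. \<forall>y\<in>{-r..r}. \<bar>R x - R y\<bar> \<le> \<eta> * \<bar>x - y\<bar>"
    define \<zeta> where "\<zeta> = (\<lambda>a. THE z. z \<in> {a - \<delta><..<a + \<delta>} \<and> h z + R z = 0)"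
    have \<zeta>: "\<zeta> a \<in> {a - \<delta><..<a + \<delta>} \<and> h (\<zeta> a) + R (\<zeta> a) = 0" if "a \<in> A" for a
      unfolding \<zeta>_def by (rule theI'[OF ex1[OF that R0 R]])
    have uniq: "z = \<zeta> a" if "a \<in> A" "z \<in> {a - \<delta><..<a + \<delta>}" "h z + R z = 0" for a z
      using ex1[OF that(1) R0 R] \<zeta>[OF that(1)] that by blast
    have inj: "inj_on \<zeta> A"
    proof (rule inj_onI, rule ccontr)
      fix a b assume "a \<in> A" "b \<in> A" "\<zeta> a = \<zeta> b" "a \<noteq> b"
      then show False using \<zeta>[of a] \<zeta>[of b] sep[of a b] by auto
    qed
    have "\<eta>-lipschitz_on {-r..r} R"
      using R \<eta> by (intro lipschitz_onI) (auto simp: dist_real_def)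
    then have "continuous_on {-r<..<r} R"
      by (rule continuous_on_subset[OF lipschitz_on_continuous_on]) auto
    then have F_cont: "continuous_on {-r<..<r} (\<lambda>x. h x + R x)"
      by (intro continuous_intros h_cont)
    have iso: "\<forall>z\<in>insert 0 (\<zeta> ` A). \<exists>e>0. \<forall>x. \<bar>x - z\<bar> < e \<longrightarrow> x \<noteq> z \<longrightarrow> h x + R x \<noteq> 0"
    proof (rule ballI, erule insertE)
      fix z :: real
      assume z: "z = 0"
      have "h 0 + R 0 \<noteq> 0" using A R0 by (simp add: h_def)
      then have "\<exists>e>0. \<forall>x. dist 0 x < e \<longrightarrow> h x + R x \<noteq> 0"
        using r by (intro continuous_on_open_avoid[OF F_cont]) auto
      then show "\<exists>e>0. \<forall>x. \<bar>x - z\<bar> < e \<longrightarrow> x \<noteq> z \<longrightarrow> h x + R x \<noteq> 0" using z by (auto simp: dist_real_def)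
    next
      fix z assume "z \<in> \<zeta> ` A"
      then obtain a where a: "a \<in> A" "z = \<zeta> a" by blast
      define e where "e = min (z - (a - \<delta>)) (a + \<delta> - z)"
      have "e > 0" using \<zeta>[OF a(1)] a by (simp add: e_def)
      moreover have "x = z" if "\<bar>x - z\<bar> < e" "h x + R x = 0" for x
      proof -
        have "x \<in> {a - \<delta><..<a + \<delta>}" using that(1) by (simp add: e_def abs_less_iff)
        then show ?thesis using uniq[OF a(1) _ that(2)] a(2) by simp
      qed
      ultimately show "\<exists>e>0. \<forall>x. \<bar>x - z\<bar> < e \<longrightarrow> x \<noteq> z \<longrightarrow> h x + R x \<noteq> 0" by blast
    qed
    have "0 \<notin> \<zeta> ` A" "\<zeta> ` A \<subseteq> {-r<..<r}"
    proof -
      show "0 \<notin> \<zeta> ` A"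
      proof
        assume "0 \<in> \<zeta> ` A"
        then obtain a where "a \<in> A" "\<zeta> a = 0" by auto
        then show False using \<zeta>[of a] \<delta>r(3)[of a] by auto
      qed
      show "\<zeta> ` A \<subseteq> {-r<..<r}"
      proof
        fix z assume "z \<in> \<zeta> ` A"
        then obtain a where "a \<in> A" "z = \<zeta> a" by auto
        then show "z \<in> {-r<..<r}" using \<zeta>[of a] \<delta>r(1,2)[of a] by auto
      qed
    qed
    define Z where "Z = \<zeta> ` A"
    have "finite Z" "card Z = card A" using A(1) inj by (simp_all add: Z_def card_image)
    moreover have "0 \<notin> Z" "Z \<subseteq> {-r<..<r}" unfolding Z_def by fact+
    moreover have "\<forall>z\<in>Z. h z + R z = 0" using \<zeta> by (auto simp: Z_def)
    moreover note iso[folded Z_def]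
    ultimately show "\<exists>Z. finite Z \<and> card Z = card A \<and> 0 \<notin> Z \<and> Z \<subseteq> {-r<..<r} \<and>
      (\<forall>z\<in>Z. h z + R z = 0) \<and>
      (\<forall>z\<in>insert 0 Z. \<exists>e>0. \<forall>x. \<bar>x - z\<bar> < e \<longrightarrow> x \<noteq> z \<longrightarrow> h x + R x \<noteq> 0)"
      by (intro exI[where x = Z]) simp
  qed
qed

section \<open>Counting limit cycles\<close>

lemma enat_card_le_set_size:
  assumes "L \<subseteq> S"
  shows "enat (card L) \<le> set_size S"
  using assms by (auto simp: set_size_def intro: card_mono)

text \<open>The limiting integral depends on the square of \<xi> only, so the roots have to be
  placed symmetrically. Pairing i with -i turns the product into a polynomial of degree
  \<open>m\<close> in x^2.\<close>

lemma signed_nat_roots: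
  fixes m :: nat
  defines "A \<equiv> (\<lambda>i. real i) ` {1..m} \<union> (\<lambda>i. - real i) ` {1..m}"
  shows "finite A" "card A = 2 * m" "0 \<notin> A" "A \<subseteq> {- real (m + 1)<..<real (m + 1)}"
    and "\<exists>e. \<forall>x. (\<Prod>a\<in>A. (x - a)) = (\<Sum>k\<le>m. e k * x ^ (2 * k))"
proof -
  have disj: "(\<lambda>i. real i) ` {1..m} \<inter> (\<lambda>i. - real i) ` {1..m} = {}" by auto
  have inj: "inj_on (\<lambda>i. real i) {1..m}" "inj_on (\<lambda>i. - real i) {1..m}" by (auto simp: inj_on_def)
  show "finite A" "0 \<notin> A" "A \<subseteq> {- real (m + 1)<..<real (m + 1)}" by (auto simp: A_def)
  show "card A = 2 * m"
    unfolding A_def using card_Un_disjoint[OF _ _ disj] card_image[OF inj(1)] card_image[OF inj(2)] by simp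
  define p :: "real poly" where "p = (\<Prod>i\<in>{1..m}. [:- ((real i)\<^sup>2), 1:])"
  have deg: "degree p = m"
    unfolding p_def by (subst degree_prod_sum_eq) auto
  have "(\<Prod>a\<in>A. (x - a)) = (\<Sum>k\<le>m. coeff p k * x ^ (2 * k))" for x
  proof -
    have "(\<Prod>a\<in>A. (x - a)) = (\<Prod>i\<in>{1..m}. x - real i) * (\<Prod>i\<in>{1..m}. x + real i)"
      unfolding A_def using prod.union_disjoint[OF _ _ disj, of "\<lambda>a. x - a"]
        prod.reindex[OF inj(1), of "\<lambda>a. x - a"] prod.reindex[OF inj(2), of "\<lambda>a. x - a"] by simp
    also have "\<dots> = poly p (x\<^sup>2)"
      unfolding p_def poly_prod prod.distrib[symmetric]
      by (rule prod.cong) (simp_all add: power2_eq_square algebra_simps)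
    finally show ?thesis unfolding poly_altdef deg by (simp add: power_mult)
  qed
  then show "\<exists>e. \<forall>x. (\<Prod>a\<in>A. (x - a)) = (\<Sum>k\<le>m. e k * x ^ (2 * k))" by blast
qed

theorem theorem5p3:
  fixes T :: real and n m :: nat
  assumes "T > 0" and "n \<ge> 1" and "m \<ge> 1"
  shows "hilbert_number T n m \<ge> enat (2 * m + 1)"
proof -
  define A where "A = (\<lambda>i. real i) ` {1..m} \<union> (\<lambda>i. - real i) ` {1..m}"
  define r where "r = real (m + 1)"
  define h where "h = (\<lambda>x. \<Prod>a\<in>A. (x - a))"
  have A: "finite A" "card A = 2 * m" "0 \<notin> A" "A \<subseteq> {-r<..<r}"
    using signed_nat_roots[of m] unfolding A_def r_def by auto
  obtain e where h: "\<And>x. h x = (\<Sum>k\<le>m. e k * x ^ (2 * k))"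
    using signed_nat_roots(5)[of m] unfolding A_def h_def by blast
  have r: "r > 0" by (simp add: r_def)
  obtain \<eta> where \<eta>: "\<eta> > 0" and roots: "\<And>R. R 0 = 0 \<Longrightarrow>
    (\<forall>x\<in>{-r..r}. \<forall>y\<in>{-r..r}. \<bar>R x - R y\<bar> \<le> \<eta> * \<bar>x - y\<bar>) \<Longrightarrow>
    (\<exists>Z. finite Z \<and> card Z = card A \<and> 0 \<notin> Z \<and> Z \<subseteq> {-r<..<r} \<and> (\<forall>z\<in>Z. h z + R z = 0) \<and>
      (\<forall>z\<in>insert 0 Z. \<exists>e>0. \<forall>x. \<bar>x - z\<bar> < e \<longrightarrow> x \<noteq> z \<longrightarrow> h x + R x \<noteq> 0))"
    using isolated_roots_lipschitz_perturbation[OF A(1,4,3) r] unfolding h_def by metis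
  define N where "N = (\<lambda>P \<xi>. integral {-T..T} (\<lambda>t. P t * sqrt (1 + 2 * \<xi>\<^sup>2 * (cosh T - cosh t))))"
  \<comment> \<open>The admissible error \<eta> is shared equally between the Taylor remainder
    \<open>R\<^sub>1\<close> and the effect \<open>R\<^sub>2\<close> of the perturbation of the
    center.\<close>
  have "\<eta> / 2 > 0" using \<eta> by simp
  from melnikov_prescribed[OF \<open>T > 0\<close> r this, of m e]
  obtain \<sigma> P R\<^sub>1 where \<sigma>: "\<sigma> > 0" and P: "P \<in> hyperbolic_poly m" and R1_0: "R\<^sub>1 0 = 0"
    and R1_lip: "\<And>x y. x \<in> {-r..r} \<Longrightarrow> y \<in> {-r..r} \<Longrightarrow> \<bar>R\<^sub>1 x - R\<^sub>1 y\<bar> \<le> \<eta> / 2 * \<bar>x - y\<bar>"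
    and N: "\<And>\<tau>. N P (\<sigma> * \<tau>) = \<sigma> ^ (2 * m) * (h \<tau> + R\<^sub>1 \<tau>)"
    unfolding N_def h by blast
  \<comment> \<open>With \<sigma> and \<open>P\<close> fixed, \<epsilon> is chosen last. Passing to
    \<tau> multiplies the Lipschitz constant by \<sigma> and dividing by the common factor
    multiplies it by \<sigma>^(-2 m), so this tolerance becomes \<eta> / 2.\<close>
  have "\<sigma> * r > 0" "\<sigma> ^ (2 * m) * (\<eta> / 2) / \<sigma> > 0" using \<sigma> r \<eta> by simp_all
  from perturbed_center[OF \<open>T > 0\<close> hyperbolic_poly_continuous_on[OF P] this]
  obtain \<epsilon> R\<^sub>2 where R2_0: "R\<^sub>2 0 = 0"
    and R2_lip: "\<And>x y. x \<in> {-(\<sigma> * r)..\<sigma> * r} \<Longrightarrow> y \<in> {-(\<sigma> * r)..\<sigma> * r} \<Longrightarrow>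
      \<bar>R\<^sub>2 x - R\<^sub>2 y\<bar> \<le> \<sigma> ^ (2 * m) * (\<eta> / 2) / \<sigma> * \<bar>x - y\<bar>"
    and ex: "\<forall>\<xi>\<in>{-(\<sigma> * r)..\<sigma> * r}. \<exists>x. abel_solution T sinh (\<lambda>t. \<epsilon> * P t) x \<and> x (-T) = \<xi> \<and>
      (x T = \<xi> \<longleftrightarrow> \<xi> * (N P \<xi> + R\<^sub>2 \<xi>) = 0)"
    unfolding N_def by blast
  define B where "B = (\<lambda>t. \<epsilon> * P t)"
  from bchoice[OF ex] obtain X where "\<forall>\<xi>\<in>{-(\<sigma> * r)..\<sigma> * r}. abel_solution T sinh B (X \<xi>) \<and> X \<xi> (-T) = \<xi> \<and>
      (X \<xi> T = \<xi> \<longleftrightarrow> \<xi> * (N P \<xi> + R\<^sub>2 \<xi>) = 0)"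
    unfolding B_def ..
  then have X: "abel_solution T sinh B (X \<xi>)" "X \<xi> (-T) = \<xi>"
    "X \<xi> T = \<xi> \<longleftrightarrow> \<xi> * (N P \<xi> + R\<^sub>2 \<xi>) = 0" if "\<xi> \<in> {-(\<sigma> * r)..\<sigma> * r}" for \<xi>
    using that by blast+
  have B: "B \<in> hyperbolic_poly m" unfolding B_def by (rule hyperbolic_poly_scale[OF P])
  have sinh: "sinh \<in> hyperbolic_poly n" using hyperbolic_poly_sinh[OF \<open>n \<ge> 1\<close>] by simp

  define R where "R = (\<lambda>\<tau>. R\<^sub>1 \<tau> + R\<^sub>2 (\<sigma> * \<tau>) / \<sigma> ^ (2 * m))"
  have NR: "N P (\<sigma> * \<tau>) + R\<^sub>2 (\<sigma> * \<tau>) = \<sigma> ^ (2 * m) * (h \<tau> + R \<tau>)" for \<tau>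
    using \<sigma> by (simp add: N R_def distrib_left)
  have scale: "\<sigma> * x \<in> {-(\<sigma> * r)..\<sigma> * r}" if "x \<in> {-r..r}" for x
    using that \<sigma> mult_left_mono[of x r \<sigma>] mult_left_mono[of "-r" x \<sigma>] by simp
  have "\<bar>R x - R y\<bar> \<le> \<eta> * \<bar>x - y\<bar>" if x: "x \<in> {-r..r}" and y: "y \<in> {-r..r}" for x y
  proof -
    have "\<bar>R\<^sub>2 (\<sigma> * x) - R\<^sub>2 (\<sigma> * y)\<bar> \<le> \<sigma> ^ (2 * m) * (\<eta> / 2) / \<sigma> * \<bar>\<sigma> * x - \<sigma> * y\<bar>"
      by (intro R2_lip scale x y)
    also have "\<bar>\<sigma> * x - \<sigma> * y\<bar> = \<sigma> * \<bar>x - y\<bar>"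
      using \<sigma> by (simp add: right_diff_distrib[symmetric] abs_mult)
    finally have "\<bar>R\<^sub>2 (\<sigma> * x) - R\<^sub>2 (\<sigma> * y)\<bar> \<le> (\<eta> / 2 * \<bar>x - y\<bar>) * \<sigma> ^ (2 * m)"
      using \<sigma> by (simp add: mult_ac)
    then have "\<bar>R\<^sub>2 (\<sigma> * x) / \<sigma> ^ (2 * m) - R\<^sub>2 (\<sigma> * y) / \<sigma> ^ (2 * m)\<bar> \<le> \<eta> / 2 * \<bar>x - y\<bar>"
      using \<sigma> by (simp add: diff_divide_distrib[symmetric] abs_divide pos_divide_le_eq)
    then show ?thesis using R1_lip[OF x y] unfolding R_def by linarith
  qed
  moreover have "R 0 = 0" by (simp add: R_def R1_0 R2_0)
  ultimately obtain Z where Z: "finite Z" "card Z = 2 * m" "0 \<notin> Z" "Z \<subseteq> {-r<..<r}"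
    and root: "\<And>z. z \<in> Z \<Longrightarrow> h z + R z = 0"
    and iso: "\<And>z. z \<in> insert 0 Z \<Longrightarrow> \<exists>e>0. \<forall>x. \<bar>x - z\<bar> < e \<longrightarrow> x \<noteq> z \<longrightarrow> h x + R x \<noteq> 0"
    using roots[of R] A(2) by metis

  define S where "S = (\<lambda>y. y (-T)) ` closed_solutions T sinh B"
  have S_iff: "\<xi> \<in> S \<longleftrightarrow> \<xi> * (N P \<xi> + R\<^sub>2 \<xi>) = 0" if \<xi>: "\<xi> \<in> {-(\<sigma> * r)..\<sigma> * r}" for \<xi>
  proof
    assume "\<xi> \<in> S"
    then obtain y where y: "abel_solution T sinh B y" "y (-T) = y T" "y (-T) = \<xi>"
      by (auto simp: S_def closed_solutions_def)
    have "y = X \<xi>"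
      by (rule abel_solution_unique[OF _ _ y(1) X(1)[OF \<xi>]])
        (use y X(2)[OF \<xi>] hyperbolic_poly_continuous_on[OF B] hyperbolic_poly_continuous_on[OF sinh] in auto)
    then show "\<xi> * (N P \<xi> + R\<^sub>2 \<xi>) = 0" using X(3)[OF \<xi>] y by auto
  next
    assume "\<xi> * (N P \<xi> + R\<^sub>2 \<xi>) = 0"
    then have "X \<xi> \<in> closed_solutions T sinh B"
      using X[OF \<xi>] by (simp add: closed_solutions_def)
    then show "\<xi> \<in> S" using X(2)[OF \<xi>] unfolding S_def by (intro image_eqI[of _ _ "X \<xi>"]) simp_all
  qed
  have S_scaled: "\<sigma> * \<tau> \<in> S \<longleftrightarrow> \<tau> = 0 \<or> h \<tau> + R \<tau> = 0" if "\<tau> \<in> {-r..r}" for \<tau>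
    using S_iff[OF scale[OF that]] \<sigma> by (simp add: NR)
  have Z0: "z \<in> {-r<..<r}" if "z \<in> insert 0 Z" for z using that Z(4) r by auto
  have lc: "X (\<sigma> * z) \<in> limit_cycles T sinh B" if z: "z \<in> insert 0 Z" for z
  proof -
    have zr: "z \<in> {-r..r}" using Z0[OF z] by auto
    have zS: "\<sigma> * z \<in> S" using S_scaled[OF zr] z root by auto
    obtain e where e: "e > 0" "\<And>x. \<bar>x - z\<bar> < e \<Longrightarrow> x \<noteq> z \<Longrightarrow> h x + R x \<noteq> 0"
      using iso[OF z] by blast
    \<comment> \<open>The three bounds exclude other roots of \<open>h + R\<close>, stay in the
      range where \<open>S_scaled\<close> applies, and exclude the zero solution when
      \<open>z\<close> is nonzero; for \<open>z = 0\<close> the value 1 is arbitrary.\<close>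
    define d where "d = min e (min (r - \<bar>z\<bar>) (if z = 0 then 1 else \<bar>z\<bar>))"
    have d: "d > 0" using e Z0[OF z] by (auto simp: d_def)
    have "\<xi> = \<sigma> * z" if "\<xi> \<in> ball (\<sigma> * z) (\<sigma> * d)" "\<xi> \<in> S" for \<xi>
    proof -
      define \<tau> where "\<tau> = \<xi> / \<sigma>"
      have \<xi>: "\<xi> = \<sigma> * \<tau>" using \<sigma> by (simp add: \<tau>_def)
      have "\<sigma> * \<bar>\<tau> - z\<bar> < \<sigma> * d"
        using that(1) \<sigma> by (simp add: \<xi> dist_real_def right_diff_distrib[symmetric] abs_mult abs_minus_commute)
      then have \<tau>: "\<bar>\<tau> - z\<bar> < d" using \<sigma> by simp
      then have "\<tau> \<in> {-r..r}" by (auto simp: d_def)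
      then have "\<tau> = 0 \<or> h \<tau> + R \<tau> = 0" using S_scaled that(2) \<xi> by blast
      then have "\<tau> = z"
      proof
        assume "\<tau> = 0"
        then show ?thesis using \<tau> by (auto simp: d_def split: if_splits)
      next
        assume "h \<tau> + R \<tau> = 0"
        then show ?thesis using e(2)[of \<tau>] \<tau> by (auto simp: d_def)
      qed
      then show ?thesis by (simp add: \<xi>)
    qed
    then have "ball (\<sigma> * z) (\<sigma> * d) \<inter> S = {\<sigma> * z}" using zS d \<sigma> by auto
    then have "\<sigma> * z isolated_in S"
      unfolding isolated_in_def using zS by blast
    moreover have "X (\<sigma> * z) \<in> closed_solutions T sinh B"
      using X[OF scale[OF zr]] zS S_iff[OF scale[OF zr]] by (simp add: closed_solutions_def)
    ultimately show ?thesis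
      using X(2)[OF scale[OF zr]] by (simp add: limit_cycles_def S_def)
  qed
  have "inj_on (\<lambda>z. X (\<sigma> * z)) (insert 0 Z)"
  proof (rule inj_onI)
    fix z w assume "z \<in> insert 0 Z" "w \<in> insert 0 Z" and eq: "X (\<sigma> * z) = X (\<sigma> * w)"
    then have "z \<in> {-r..r}" "w \<in> {-r..r}" using Z0 by force+
    then have "\<sigma> * z = \<sigma> * w" using X(2)[OF scale] eq by metis
    then show "z = w" using \<sigma> by simp
  qed
  then have "card ((\<lambda>z. X (\<sigma> * z)) ` insert 0 Z) = 2 * m + 1"
    using Z by (simp add: card_image)
  moreover have "(\<lambda>z. X (\<sigma> * z)) ` insert 0 Z \<subseteq> limit_cycles T sinh B" using lc by blast
  ultimately have "enat (2 * m + 1) \<le> set_size (limit_cycles T sinh B)"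
    using enat_card_le_set_size by metis
  also have "\<dots> \<le> hilbert_number T n m"
    unfolding hilbert_number_def using sinh B by (intro SUP_upper2[of "(sinh, B)"]) auto
  finally show ?thesis .
qed

end
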